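(* For all positive coprime integers $a,b$, the multiplicity sequence of the Ooms spectrum of $W(a,b)$ (multiplicities ordered by increasing distinct eigenvalue) is strictly unimodal with a central pair. The two central eigenvalues (those whose multiplicities are the two equal middle terms) are $0$ and $1$.
   Context: For positive integers $a,b$, let $$W(a,b)=\left\{\begin{pmatrix}X&Z\\0&Y\end{pmatrix}: X\in\operatorname{Mat}_a(\mathbb C),\ Y\in\operatorname{Mat}_b(\mathbb C),\ Z\in\operatorname{Mat}_{a\times b}(\mathbb C),\ \operatorname{tr}X+\operatorname{tr}Y=0\right\},$$ a Lie algebra under the commutator (a maximal parabolic of type $A$). A finite-dimensional complex Lie algebra $\mathfrak g$ is Frobenius if there is $\varphi\in\mathfrak g^*$ such that the bilinear form $B_\varphi(x,y)=\varphi([x,y])$ is nondegenerate; such $\varphi$ is called a Frobenius functional and determines a unique principal element $h\in\mathfrak g$ by $\varphi([h,x])=\varphi(x)$ for all $x\in\mathfrak g$. It is known that $W(a,b)$ is Frobenius exactly when $\gcd(a,b)=1$, and that the multiset of eigenvalues of $\operatorname{ad}h$ (with algebraic multiplicities) does not depend on the choice of Frobenius functional; this multiset is the Ooms spectrum. The distinct eigenvalues are integers. The multiplicity sequence is the sequence of multiplicities, listed in order of increasing distinct eigenvalue. A finite sequence is strictly unimodal with a central pair if it is strictly increasing up to two equal middle terms and strictly decreasing thereafter (the two-term sequence $(1,1)$ is allowed). *)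

theory Defs
  imports "Jordan_Normal_Form.VS_Connect" "Jordan_Normal_Form.Char_Poly" "HOL-Library.Multiset"
begin

text \<open>A finite-dimensional complex Lie algebra is given by a vector space \<open>V\<close> over
  \<open>class_ring :: complex ring\<close> and a bracket \<open>br\<close>, of which only the values on
  \<open>carrier V\<close> matter.  Likewise a functional \<open>\<phi>\<close> is only relevant on \<open>carrier V\<close>.\<close>

definition linear_functional :: "(complex, 'v) module \<Rightarrow> ('v \<Rightarrow> complex) \<Rightarrow> bool" where
  "linear_functional V \<phi> \<longleftrightarrow>
     (\<forall>x\<in>carrier V. \<forall>y\<in>carrier V. \<phi> (x \<oplus>\<^bsub>V\<^esub> y) = \<phi> x + \<phi> y) \<and>
     (\<forall>c. \<forall>x\<in>carrier V. \<phi> (c \<odot>\<^bsub>V\<^esub> x) = c * \<phi> x)"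

text \<open>The form \<open>\<phi> (br x y)\<close> is skew-symmetric, so its left radical is its radical.\<close>

definition frobenius_functional ::
  "(complex, 'v) module \<Rightarrow> ('v \<Rightarrow> 'v \<Rightarrow> 'v) \<Rightarrow> ('v \<Rightarrow> complex) \<Rightarrow> bool" where
  "frobenius_functional V br \<phi> \<longleftrightarrow> linear_functional V \<phi> \<and>
     (\<forall>x\<in>carrier V. (\<forall>y\<in>carrier V. \<phi> (br x y) = 0) \<longrightarrow> x = \<zero>\<^bsub>V\<^esub>)"

definition principal_element ::
  "(complex, 'v) module \<Rightarrow> ('v \<Rightarrow> 'v \<Rightarrow> 'v) \<Rightarrow> ('v \<Rightarrow> complex) \<Rightarrow> 'v \<Rightarrow> bool" where
  "principal_element V br \<phi> h \<longleftrightarrow> h \<in> carrier V \<and> (\<forall>x\<in>carrier V. \<phi> (br h x) = \<phi> x)"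

definition ordered_basis :: "(complex, 'v) module \<Rightarrow> 'v list \<Rightarrow> bool" where
  "ordered_basis V bs \<longleftrightarrow> distinct bs \<and> vectorspace.basis class_ring V (set bs)"

text \<open>Column \<open>j\<close> of \<open>M\<close> holds the coordinates of the image of the \<open>j\<close>-th basis vector.\<close>

definition represents ::
  "(complex, 'v) module \<Rightarrow> ('v \<Rightarrow> 'v) \<Rightarrow> 'v list \<Rightarrow> complex mat \<Rightarrow> bool" where
  "represents V T bs M \<longleftrightarrow> M \<in> carrier_mat (length bs) (length bs) \<and>
     (\<forall>j<length bs. T (bs ! j) = (\<Oplus>\<^bsub>V\<^esub>i\<in>{..<length bs}. M $$ (i, j) \<odot>\<^bsub>V\<^esub> bs ! i))"

text \<open>The characteristic polynomial of an endomorphism is that of its matrix in any basis; the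
  description is proper because a change of basis conjugates the matrix.\<close>

definition operator_char_poly :: "(complex, 'v) module \<Rightarrow> ('v \<Rightarrow> 'v) \<Rightarrow> complex poly" where
  "operator_char_poly V T =
     (THE p. \<exists>bs M. ordered_basis V bs \<and> represents V T bs M \<and> p = char_poly M)"

text \<open>The definite description expresses that the multiset of eigenvalues of \<open>ad h\<close>, with
  algebraic multiplicities, does not depend on the Frobenius functional; it is proper only for
  Frobenius Lie algebras.\<close>

definition ooms_spectrum ::
  "(complex, 'v) module \<Rightarrow> ('v \<Rightarrow> 'v \<Rightarrow> 'v) \<Rightarrow> complex multiset" where
  "ooms_spectrum V br =
     (THE S. \<exists>\<phi> h. frobenius_functional V br \<phi> \<and> principal_element V br \<phi> h \<and>
        S = proots (operator_char_poly V (br h)))"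

definition commutator :: "complex mat \<Rightarrow> complex mat \<Rightarrow> complex mat" where
  "commutator A B = A * B - B * A"

definition mat_trace :: "complex mat \<Rightarrow> complex" where
  "mat_trace A = sum_list (diag_mat A)"

definition parabolic :: "nat \<Rightarrow> nat \<Rightarrow> (complex, complex mat) module" where
  "parabolic a b = module_mat TYPE(complex) (a + b) (a + b)
     \<lparr>carrier := {four_block_mat X Z (0\<^sub>m b a) Y | X Y Z.
        X \<in> carrier_mat a a \<and> Y \<in> carrier_mat b b \<and> Z \<in> carrier_mat a b \<and>
        mat_trace X + mat_trace Y = 0}\<rparr>"

text \<open>\<open>ks\<close> lists all distinct elements of \<open>S\<close> in increasing order; this forces all of them
  to be integers.\<close>

definition increasing_eigenvalues :: "complex multiset \<Rightarrow> int list \<Rightarrow> bool" where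
  "increasing_eigenvalues S ks \<longleftrightarrow> sorted_wrt (<) ks \<and> of_int ` set ks = set_mset S"

definition multiplicity_sequence :: "complex multiset \<Rightarrow> int list \<Rightarrow> nat list" where
  "multiplicity_sequence S ks = map (\<lambda>k. count S (of_int k)) ks"

text \<open>The two equal terms occupy the two middle positions of a sequence of even length.\<close>

definition strictly_unimodal_central_pair :: "nat list \<Rightarrow> bool" where
  "strictly_unimodal_central_pair ms \<longleftrightarrow>
     (\<exists>k>0. length ms = 2 * k \<and> sorted_wrt (<) (take k ms) \<and>
        ms ! (k - 1) = ms ! k \<and> sorted_wrt (>) (drop k ms))"

end

theory Submission
  imports Defs "Jordan_Normal_Form.Schur_Decomposition" "Jordan_Normal_Form.Gauss_Jordan_Elimination"
begin

text \<open>
Let \<open>n = a + b\<close> and write a functional on the parabolic algebra as \<open>\<phi>(x) = tr (F x)\<close> with a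
traceless matrix \<open>F\<close>, where only the entries of \<open>F\<close> outside the upper right \<open>a \<times> b\<close> block matter.  In
terms of \<open>F\<close>, the functional is Frobenius iff the only block upper triangular \<open>h\<close> with
\<open>[F, h] \<equiv> 0\<close> modulo the upper right block are the scalars, and \<open>h\<close> is principal iff
\<open>[F, h] \<equiv> F\<close>.

\<^bold>\<open>The spectrum.\<close>  Let \<open>a \<le> b\<close> and let \<open>C\<close> be the lower left block of \<open>F\<close>.  If \<open>C u = 0\<close> with \<open>u \<noteq> 0\<close>,
there is also \<open>w \<noteq> 0\<close> with \<open>w\<^sup>T C = 0\<close>, and the matrix whose upper right block is \<open>u w\<^sup>T\<close> violates
nondegeneracy; so \<open>C\<close> is injective, and conjugation by a block upper triangular matrix turns \<open>F\<close>
into the normal form with upper left block \<open>0\<close>, lower left block the inclusion of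
\<open>\<complex>\<^sup>a\<close> into \<open>\<complex>\<^sup>b\<close>, and some \<open>b \<times> b\<close> matrix \<open>F'\<close> (\<open>frobenius_normal_form\<close>).  In normal form the
conditions on \<open>h\<close> with diagonal blocks \<open>X\<close>, \<open>Y\<close> say that \<open>Y\<close> itself is block upper triangular of type
\<open>(a, b - a)\<close>, that it satisfies the same condition with respect to \<open>F'\<close>, and that \<open>X\<close> is the upper
left block of \<open>Y\<close> plus \<open>1\<close> (\<open>normal_form_reduce\<close>, \<open>normal_form_extend\<close>).  Thus every Frobenius
functional of type \<open>(a, b)\<close> reduces to one of type \<open>(a, b - a)\<close>, and conversely.  Together with the
isomorphism \<open>flip\<close> from type \<open>(a, b)\<close> to type \<open>(b, a)\<close>, this is the Euclidean algorithm: it ends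
at type \<open>(0, 1)\<close>, proves that Frobenius functionals exist for coprime \<open>a\<close>, \<open>b\<close>, and shows that the
eigenvalues of the two diagonal blocks of a principal element are, up to a common shift, two
multisets \<open>P\<close>, \<open>Q\<close> of integers (\<open>principal_pair\<close>, \<open>principal_block_spectra\<close>).  After triangularising
the diagonal blocks, \<open>ad h\<close> is triangular in a basis of matrix units ordered by \<open>i - j\<close>, so its
eigenvalues are the differences within \<open>P\<close>, within \<open>Q\<close>, and from \<open>P\<close> to \<open>Q\<close>, with one \<open>0\<close> removed because
of the trace condition (\<open>proots_commutator_block_upper\<close>).

\<^bold>\<open>Unimodality.\<close>  Let \<open>\<alpha>(k)\<close>, \<open>\<beta>(k)\<close>, \<open>m(k)\<close> count the differences \<open>k\<close> within \<open>P\<close>, within \<open>Q\<close>, and from \<open>P\<close> to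
\<open>Q\<close>.  A step of the recursion keeps \<open>\<alpha>\<close>, replaces \<open>\<beta>(k)\<close> by \<open>\<alpha>(k) + \<beta>(k) + m(k) + m(-k)\<close> and \<open>m(k)\<close> by
\<open>\<alpha>(k - 1) + m(k - 1)\<close>.  The property \<open>balanced\<close> of such triples is invariant under this step and
under exchanging \<open>\<alpha>\<close> and \<open>\<beta>\<close>.  It implies for the multiplicities
\<open>c(k) = \<alpha>(k) + \<beta>(k) + m(k) - [k = 0]\<close> that \<open>c(1 - k) = c(k)\<close> and \<open>c(k) - c(k + 1) = m(k) - m(-k)\<close>, where
the last number is positive for all \<open>k \<ge> 1\<close> with \<open>c(k) > 0\<close>.
\<close>

section \<open>Multisets of differences and principal pairs\<close>

text \<open>The multiset of all differences \<open>x - y\<close> with \<open>x\<close> from \<open>P\<close> and \<open>y\<close> from \<open>Q\<close>, with multiplicities.\<close>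

definition diff_mset :: "'a::ab_group_add multiset \<Rightarrow> 'a multiset \<Rightarrow> 'a multiset" where
  "diff_mset P Q = (\<Sum>x\<in>#P. image_mset (\<lambda>y. x - y) Q)"

lemma diff_mset_empty [simp]: "diff_mset {#} Q = {#}" "diff_mset P {#} = {#}"
  by (simp_all add: diff_mset_def)

lemma diff_mset_add_mset_left: "diff_mset (add_mset x P) Q = image_mset (\<lambda>y. x - y) Q + diff_mset P Q"
  by (simp add: diff_mset_def)

lemma diff_mset_union_left: "diff_mset (P + P') Q = diff_mset P Q + diff_mset P' Q"
  by (simp add: diff_mset_def)

lemma diff_mset_union_right: "diff_mset P (Q + Q') = diff_mset P Q + diff_mset P Q'"
  by (induction P) (simp_all add: diff_mset_add_mset_left)

lemma diff_mset_add_mset_right: "diff_mset P (add_mset y Q) = image_mset (\<lambda>x. x - y) P + diff_mset P Q"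
  by (induction P) (simp_all add: diff_mset_add_mset_left)

lemma diff_mset_swap: "diff_mset Q P = image_mset uminus (diff_mset P Q)"
proof (induction P)
  case (add x P)
  have "image_mset (\<lambda>y. y - x) Q = image_mset uminus (image_mset (\<lambda>y. x - y) Q)"
    by (simp add: image_mset.compositionality comp_def)
  then show ?case using add by (simp add: diff_mset_add_mset_left diff_mset_add_mset_right)
qed simp

lemma diff_mset_neg: "diff_mset (image_mset uminus P) (image_mset uminus Q) = diff_mset Q P"
proof -
  have "diff_mset (image_mset uminus P) (image_mset uminus Q) = image_mset uminus (diff_mset P Q)"
    by (induction P)
      (simp_all add: diff_mset_add_mset_left image_mset.compositionality comp_def add.commute)
  then show ?thesis by (simp add: diff_mset_swap[of Q P])
qed

lemma diff_mset_shift_left: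
  "diff_mset (image_mset (\<lambda>x. x + c) P) Q = image_mset (\<lambda>x. x + c) (diff_mset P Q)"
  by (induction P)
    (simp_all add: diff_mset_add_mset_left image_mset.compositionality comp_def algebra_simps)

lemma diff_mset_shift_both:
  "diff_mset (image_mset (\<lambda>x. x + c) P) (image_mset (\<lambda>x. x + c) Q) = diff_mset P Q"
  by (induction P)
    (simp_all add: diff_mset_add_mset_left image_mset.compositionality comp_def algebra_simps)

lemma diff_mset_of_int:
  "diff_mset (image_mset of_int P) (image_mset of_int Q)
    = image_mset (of_int :: int \<Rightarrow> 'a::ring_1) (diff_mset P Q)"
  by (induction P)
    (simp_all add: diff_mset_add_mset_left image_mset.compositionality comp_def algebra_simps)

lemma count_image_inj: "inj f \<Longrightarrow> count (image_mset f M) (f x) = count M x"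
  by (induction M) (auto dest: injD)

lemma count_image_uminus: "count (image_mset uminus M) k = count M (- k :: 'a::ab_group_add)"
  using count_image_inj[of uminus M "- k"] by simp

lemma count_image_shift: "count (image_mset (\<lambda>x. x + c) M) k = count M (k - c :: 'a::ab_group_add)"
  using count_image_inj[of "\<lambda>x. x + c" M "k - c"] by (simp add: inj_def)

text \<open>The eigenvalues of the two diagonal blocks of a principal element of type \<open>(a, b)\<close>, normalised by
  a common shift.  The recursion is the Euclidean algorithm on \<open>(a, b)\<close>; the values are meaningful
  for coprime \<open>a\<close>, \<open>b\<close> only.\<close>

function principal_pair :: "nat \<Rightarrow> nat \<Rightarrow> int multiset \<times> int multiset" where
  "principal_pair a b =
     (if a = 0 then ({#}, {#0#})
      else if a \<le> b then
        (let (P, Q) = principal_pair a (b - a) in (image_mset (\<lambda>x. x + 1) P, P + Q))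
      else (let (P, Q) = principal_pair b a in (image_mset uminus Q, image_mset uminus P)))"
  by auto
termination
  by (relation "measure (\<lambda>(a, b). 2 * (a + b) + (if b < a then 1 else 0))") auto

declare principal_pair.simps [simp del]

section \<open>Balanced triples and unimodality\<close>

text \<open>The invariants of the counting functions of the differences within \<open>P\<close>, within \<open>Q\<close>, and from \<open>P\<close> to
  \<open>Q\<close>.  The first two are symmetric and decrease away from \<open>0\<close>, and \<open>m j \<le> m i\<close> whenever \<open>j < i\<close>
  and \<open>i + j \<le> 1\<close>.  The equation expresses the symmetry of the spectrum under \<open>k \<mapsto> 1 - k\<close> by first
  differences; the last clause is the strict unimodality.\<close>

definition balanced :: "(int \<Rightarrow> int) \<Rightarrow> (int \<Rightarrow> int) \<Rightarrow> (int \<Rightarrow> int) \<Rightarrow> bool" where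
  "balanced \<alpha> \<beta> m \<longleftrightarrow>
     (\<forall>k. \<alpha> (- k) = \<alpha> k) \<and> (\<forall>k\<ge>0. \<alpha> (k + 1) \<le> \<alpha> k) \<and> \<alpha> 1 < \<alpha> 0 \<and>
     (\<forall>k. \<beta> (- k) = \<beta> k) \<and> (\<forall>k\<ge>0. \<beta> (k + 1) \<le> \<beta> k) \<and> \<beta> 1 < \<beta> 0 \<and>
     (\<forall>k. 0 \<le> \<alpha> k \<and> 0 \<le> \<beta> k \<and> 0 \<le> m k) \<and> 0 < m 1 \<and>
     (\<forall>i j. j < i \<longrightarrow> i + j \<le> 1 \<longrightarrow> m j \<le> m i) \<and>
     (\<forall>k. (\<alpha> k + \<beta> k - (if k = 0 then 1 else 0)) - (\<alpha> (k - 1) + \<beta> (k - 1) - (if k = 1 then 1 else 0))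
          = m (1 - k) - m k) \<and>
     (\<forall>k\<ge>1. 0 < \<alpha> k + \<beta> k + m k \<longrightarrow> m (- k) < m k)"

lemma balancedD:
  assumes "balanced \<alpha> \<beta> m"
  shows "\<alpha> (- k) = \<alpha> k" "0 \<le> k \<Longrightarrow> \<alpha> (k + 1) \<le> \<alpha> k" "\<alpha> 1 < \<alpha> 0"
    "\<beta> (- k) = \<beta> k" "0 \<le> k \<Longrightarrow> \<beta> (k + 1) \<le> \<beta> k" "\<beta> 1 < \<beta> 0"
    "0 \<le> \<alpha> k" "0 \<le> \<beta> k" "0 \<le> m k" "0 < m 1"
    "j < i \<Longrightarrow> i + j \<le> 1 \<Longrightarrow> m j \<le> m i"
    "(\<alpha> k + \<beta> k - (if k = 0 then 1 else 0)) - (\<alpha> (k - 1) + \<beta> (k - 1) - (if k = 1 then 1 else 0))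
          = m (1 - k) - m k"
    "1 \<le> k \<Longrightarrow> 0 < \<alpha> k + \<beta> k + m k \<Longrightarrow> m (- k) < m k"
  using assms unfolding balanced_def by blast+

lemma balanced_swap: "balanced \<alpha> \<beta> m \<Longrightarrow> balanced \<beta> \<alpha> m"
  unfolding balanced_def by (auto simp: algebra_simps)

lemma balanced_base:
  "balanced (\<lambda>k. if k = 0 then 1 else 0) (\<lambda>k. if k = 0 then 1 else 0) (\<lambda>k. if k = 1 then 1 else 0)"
  unfolding balanced_def by auto

lemma decreasing_in_abs:
  fixes \<alpha> :: "int \<Rightarrow> int"
  assumes sym: "\<And>k. \<alpha> (- k) = \<alpha> k" and dec: "\<And>k. 0 \<le> k \<Longrightarrow> \<alpha> (k + 1) \<le> \<alpha> k"
    and "\<bar>i\<bar> \<le> \<bar>j\<bar>"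
  shows "\<alpha> j \<le> \<alpha> i"
proof -
  have mono: "\<alpha> (i + int n) \<le> \<alpha> i" if "0 \<le> i" for i n
  proof (induction n)
    case (Suc n)
    have "\<alpha> (i + int n + 1) \<le> \<alpha> (i + int n)" using that by (intro dec) simp
    then show ?case using Suc by (simp add: algebra_simps)
  qed simp
  have "\<alpha> \<bar>j\<bar> \<le> \<alpha> \<bar>i\<bar>" using mono[of "\<bar>i\<bar>" "nat (\<bar>j\<bar> - \<bar>i\<bar>)"] assms(3) by simp
  moreover have "\<alpha> \<bar>k\<bar> = \<alpha> k" for k using sym[of k] by (simp add: abs_if)
  ultimately show ?thesis by simp
qed

text \<open>Where the strict inequality degenerates, the triple has already left its support, and the next
  multiplicity vanishes as well.\<close>

lemma balanced_vanish:
  assumes bal: "balanced \<alpha> \<beta> m" and k: "1 \<le> k" and eq: "m (- k) = m k"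
  shows "\<alpha> k = 0" "\<beta> k = 0" "m k = 0" "\<alpha> (k + 1) + \<beta> (k + 1) + m (k + 1) = 0"
proof -
  note D = balancedD[OF bal]
  have "\<not> 0 < \<alpha> k + \<beta> k + m k" using D(13)[OF k] eq by auto
  then show z: "\<alpha> k = 0" "\<beta> k = 0" "m k = 0" using D(7-9)[of k] by linarith+
  show "\<alpha> (k + 1) + \<beta> (k + 1) + m (k + 1) = 0"
    using D(12)[of "k + 1"] D(7-9)[of "k + 1"] k z eq by simp
qed

text \<open>One step of the Euclidean algorithm preserves the invariants.\<close>

lemma balanced_step:
  assumes bal: "balanced \<alpha> \<beta> m"
  shows "balanced \<alpha> (\<lambda>k. \<alpha> k + \<beta> k + m k + m (- k)) (\<lambda>k. \<alpha> (k - 1) + m (k - 1))"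
    (is "balanced \<alpha> ?\<beta> ?m")
proof -
  note D = balancedD[OF bal]
  note dec = decreasing_in_abs[OF D(1) D(2)]
  \<comment> \<open>The symmetry equation turns the differences of the new \<open>\<beta>\<close> into differences of values of \<open>m\<close>.\<close>
  have beta_step: "?\<beta> k - ?\<beta> (k + 1) = (if k = 0 then 1 else 0) + m k - m (- k - 1)" if "0 \<le> k" for k
    using D(12)[of "k + 1"] that by (auto split: if_splits)
  have strict: "?m (- k) < ?m k" if k: "1 \<le> k" and pos: "0 < \<alpha> k + ?\<beta> k + ?m k" for k
  proof (rule ccontr)
    assume neg: "\<not> ?m (- k) < ?m k"
    have a: "\<alpha> (k + 1) \<le> \<alpha> k" "\<alpha> k \<le> \<alpha> (k - 1)" "\<alpha> (- k - 1) = \<alpha> (k + 1)"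
      using k dec[of k "k + 1"] dec[of "k - 1" k] D(1)[of "k + 1"] by simp_all
    have b: "m (- k - 1) \<le> m (- k)" "m (- k) \<le> m (1 - k)" using k by (auto intro!: D(11))
    have c: "m (1 - k) \<le> m (k - 1)" using k D(11)[of "1 - k" "k - 1"] by (cases "k = 1") auto
    \<comment> \<open>The inequalities leave no room: equality must hold in each of them.\<close>
    have eq: "\<alpha> (k + 1) = \<alpha> k" "\<alpha> k = \<alpha> (k - 1)" "m (1 - k) = m (k - 1)" "m (- k) = m (k - 1)"
      using a b c neg by (simp_all add: algebra_simps)
    show False
    proof (cases "k = 1")
      case True
      then show False using eq D(3) by simp
    next
      case False
      have "m (- (k - 1)) = m (k - 1)" "1 \<le> k - 1" using eq False k by simp_all
      from balanced_vanish[OF bal this(2,1)] eq D(7-9)[of k] pos show False by simp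
    qed
  qed
  show ?thesis
    unfolding balanced_def
  proof (intro conjI allI impI)
    fix k :: int
    show "?\<beta> (- k) = ?\<beta> k" using D(1,4) by simp
    show "0 \<le> k \<Longrightarrow> ?\<beta> (k + 1) \<le> ?\<beta> k" using beta_step[of k] D(11)[of "- k - 1" k] by (simp split: if_splits)
    show "?\<beta> 1 < ?\<beta> 0" using beta_step[of 0] D(11)[of "-1" 0] by simp
    show "0 < ?m 1" using D(3) D(7)[of 1] D(9)[of 0] by simp
    show "\<alpha> k + ?\<beta> k - (if k = 0 then 1 else 0) - (\<alpha> (k - 1) + ?\<beta> (k - 1) - (if k = 1 then 1 else 0))
        = ?m (1 - k) - ?m k"
      using D(12)[of k] D(1)[of k] by (simp add: algebra_simps)
  next
    fix i j :: int
    assume "j < i" "i + j \<le> 1"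
    then have "\<bar>i - 1\<bar> \<le> \<bar>j - 1\<bar>" "m (j - 1) \<le> m (i - 1)" by (auto intro: D(11))
    then show "?m j \<le> ?m i" using dec[of "i - 1" "j - 1"] by simp
  qed (use D strict in \<open>simp_all add: add_nonneg_nonneg\<close>)
qed

text \<open>The differences within \<open>P\<close>, within \<open>Q\<close> and from \<open>P\<close> to \<open>Q\<close> belong to all block upper triangular matrices;
  the trace condition removes one eigenvalue \<open>0\<close>.\<close>

definition parabolic_spectrum :: "nat \<Rightarrow> nat \<Rightarrow> int multiset" where
  "parabolic_spectrum a b =
     (let (P, Q) = principal_pair a b in diff_mset P P + diff_mset Q Q + diff_mset P Q - {#0#})"

lemma balanced_principal_pair:
  assumes "coprime a b" "0 < a" "0 < b" "principal_pair a b = (P, Q)"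
  shows "balanced (\<lambda>k. int (count (diff_mset P P) k)) (\<lambda>k. int (count (diff_mset Q Q) k))
           (\<lambda>k. int (count (diff_mset P Q) k))"
  using assms
proof (induction a b arbitrary: P Q rule: principal_pair.induct)
  case (1 a b)
  consider "a = b" | "a < b" | "b < a" by linarith
  then show ?case
  proof cases
    case 1
    then have "a = 1" "b = 1" using "1.prems" by auto
    then have "P = {#1#}" "Q = {#0#}" using "1.prems"(4) by (simp_all add: principal_pair.simps)
    then have "(\<lambda>k. int (count (diff_mset P P) k)) = (\<lambda>k. if k = 0 then 1 else 0)"
       "(\<lambda>k. int (count (diff_mset Q Q) k)) = (\<lambda>k. if k = 0 then 1 else 0)"
       "(\<lambda>k. int (count (diff_mset P Q) k)) = (\<lambda>k. if k = 1 then 1 else 0)"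
      by (auto simp: diff_mset_def)
    then show ?thesis using balanced_base by simp
  next
    case 2
    obtain P' Q' where IH: "principal_pair a (b - a) = (P', Q')" by force
    then have PQ: "P = image_mset (\<lambda>x. x + 1) P'" "Q = P' + Q'"
      using "1.prems" 2 by (simp_all add: principal_pair.simps[of a b])
    have "coprime a (b - a)"
      using "1.prems"(1) 2 by (metis coprime_diff_one_left_nat coprime_iff_gcd_eq_1 gcd.commute gcd_diff1_nat less_imp_le_nat)
    then have bal: "balanced (\<lambda>k. int (count (diff_mset P' P') k)) (\<lambda>k. int (count (diff_mset Q' Q') k))
           (\<lambda>k. int (count (diff_mset P' Q') k))"
      using "1.IH"(1)[OF _ _ _ _ _ IH] "1.prems" 2 by simp
    show ?thesis
      unfolding PQ diff_mset_shift_both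
      using balanced_step[OF bal]
      by (simp add: diff_mset_union_left diff_mset_union_right diff_mset_shift_left count_image_shift
          diff_mset_swap[of Q' P'] count_image_uminus add_ac)
  next
    case 3
    obtain P' Q' where IH: "principal_pair b a = (P', Q')" by force
    then have PQ: "P = image_mset uminus Q'" "Q = image_mset uminus P'"
      using "1.prems" 3 by (simp_all add: principal_pair.simps[of a b])
    show ?thesis
      unfolding PQ diff_mset_neg
      using "1.IH"(2)[OF _ _ _ _ _ IH] "1.prems" 3 by (simp add: balanced_swap coprime_commute)
  qed
qed

text \<open>A multiplicity function that is symmetric under \<open>k \<mapsto> 1 - k\<close> and strictly decreasing on \<open>k \<ge> 1\<close>
  until it vanishes lists as a strictly unimodal sequence whose central pair belongs to \<open>0\<close> and \<open>1\<close>.\<close>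

lemma central_pair_of_symmetric_decreasing:
  fixes c :: "int \<Rightarrow> nat" and S :: "complex multiset"
  assumes sym: "\<And>k. c (1 - k) = c k"
    and dec: "\<And>k. 1 \<le> k \<Longrightarrow> 0 < c k \<Longrightarrow> c (k + 1) < c k"
    and zero: "\<And>k. 1 \<le> k \<Longrightarrow> c k = 0 \<Longrightarrow> c (k + 1) = 0"
    and pos: "0 < c 1" and fin: "finite {k. 0 < c k}"
    and count: "\<And>k. count S (of_int k) = c k" and int: "set_mset S \<subseteq> range of_int"
  shows "\<exists>ks. increasing_eigenvalues S ks \<and>
           strictly_unimodal_central_pair (multiplicity_sequence S ks) \<and>
           ks ! (length ks div 2 - 1) = 0 \<and> ks ! (length ks div 2) = 1"
proof -
  define K where "K = nat (Max {k. 0 < c k})"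
  have max1: "1 \<le> Max {k. 0 < c k}" using pos fin by (intro Max_ge) auto
  then have K: "0 < K" and intK: "int K = Max {k. 0 < c k}" unfolding K_def by simp_all
  have "c (int K) > 0" using Max_in[OF fin] pos unfolding intK by auto
  have upper: "k \<le> int K" if "0 < c k" for k using that fin unfolding intK by simp
  have vanish: "c (1 + int i + int n) = 0" if "c (1 + int i) = 0" for i n
  proof (induction n)
    case (Suc n)
    then show ?case using zero[of "1 + int i + int n"] by (simp add: add_ac)
  qed (use that in simp)
  have posK: "0 < c k" if "1 \<le> k" "k \<le> int K" for k
  proof (rule ccontr)
    assume "\<not> 0 < c k"
    then have "c (1 + int (nat (k - 1)) + int (nat (int K - k))) = 0"
      using that by (intro vanish) simp
    then show False using that \<open>c (int K) > 0\<close> by simp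
  qed
  have dec_seq: "c (i + 1 + int n) < c i" if "1 \<le> i" "i + int n < int K" for i n
    using that
  proof (induction n)
    case 0
    then show ?case using dec[of i] posK[of i] by simp
  next
    case (Suc n)
    then show ?case using dec[of "i + 1 + int n"] posK[of "i + 1 + int n"] by (simp add: add_ac)
  qed
  have anti: "c j < c i" if "1 \<le> i" "i < j" "j \<le> int K" for i j
    using dec_seq[of i "nat (j - i - 1)"] that by simp
  define ks where "ks = [1 - int K..int K]"
  have len: "length ks = 2 * K" and nth: "\<And>i. i < 2 * K \<Longrightarrow> ks ! i = 1 - int K + int i"
    unfolding ks_def by (simp_all add: nth_upto)
  have "of_int ` set ks = set_mset S"
  proof
    show "of_int ` set ks \<subseteq> set_mset S"
    proof
      fix x :: complex assume "x \<in> of_int ` set ks"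
      then obtain k where k: "x = of_int k" "1 - int K \<le> k" "k \<le> int K" unfolding ks_def by auto
      have "0 < c k" using posK[of k] posK[of "1 - k"] sym[of k] k by (cases "1 \<le> k") auto
      then show "x \<in># S" unfolding k(1) by (metis count count_greater_zero_iff)
    qed
    show "set_mset S \<subseteq> of_int ` set ks"
    proof
      fix x assume x: "x \<in># S"
      then obtain k where k: "x = of_int k" using int by auto
      have "0 < c k" using x unfolding k by (metis count count_greater_zero_iff)
      then have "k \<le> int K" "1 - k \<le> int K" using upper sym by simp_all
      then show "x \<in> of_int ` set ks" unfolding k ks_def by auto
    qed
  qed
  then have inc: "increasing_eigenvalues S ks"
    unfolding increasing_eigenvalues_def
    by (simp add: ks_def)
  have ms: "length (multiplicity_sequence S ks) = 2 * K"
    "\<And>i. i < 2 * K \<Longrightarrow> multiplicity_sequence S ks ! i = c (1 - int K + int i)"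
    unfolding multiplicity_sequence_def using len nth by (simp_all add: count)
  have "strictly_unimodal_central_pair (multiplicity_sequence S ks)"
    unfolding strictly_unimodal_central_pair_def
  proof (intro exI[of _ K] conjI)
    show "sorted_wrt (<) (take K (multiplicity_sequence S ks))"
      unfolding sorted_wrt_iff_nth_less
    proof (intro allI impI)
      fix i j assume ij: "i < j" "j < length (take K (multiplicity_sequence S ks))"
      then have "c (int K - int i) < c (int K - int j)" using ms(1) by (intro anti) auto
      then have "c (1 - int K + int i) < c (1 - int K + int j)"
        using sym[of "1 - int K + int i"] sym[of "1 - int K + int j"] by (simp add: algebra_simps)
      then show "take K (multiplicity_sequence S ks) ! i < take K (multiplicity_sequence S ks) ! j"
        using ij ms by simp
    qed
    show "sorted_wrt (>) (drop K (multiplicity_sequence S ks))"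
      unfolding sorted_wrt_iff_nth_less
    proof (intro allI impI)
      fix i j assume ij: "i < j" "j < length (drop K (multiplicity_sequence S ks))"
      then have "c (1 + int j) < c (1 + int i)" using ms(1) by (intro anti) auto
      then show "drop K (multiplicity_sequence S ks) ! j < drop K (multiplicity_sequence S ks) ! i"
        using ij ms by simp
    qed
    show "multiplicity_sequence S ks ! (K - 1) = multiplicity_sequence S ks ! K"
      using ms(2)[of "K - 1"] ms(2)[of K] K sym[of 0] by (simp add: of_nat_diff)
  qed (use K ms in auto)
  then show ?thesis using inc len nth[of "K - 1"] nth[of K] K by (intro exI[of _ ks]) (simp add: of_nat_diff)
qed

lemma parabolic_spectrum_unimodal:
  assumes "coprime a b" "0 < a" "0 < b"
  defines "S \<equiv> image_mset of_int (parabolic_spectrum a b) :: complex multiset"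
  shows "\<exists>ks. increasing_eigenvalues S ks \<and>
           strictly_unimodal_central_pair (multiplicity_sequence S ks) \<and>
           ks ! (length ks div 2 - 1) = 0 \<and> ks ! (length ks div 2) = 1"
proof -
  obtain P Q where PQ: "principal_pair a b = (P, Q)" by force
  define \<alpha> \<beta> m where "\<alpha> = (\<lambda>k. int (count (diff_mset P P) k))" and
    "\<beta> = (\<lambda>k. int (count (diff_mset Q Q) k))" and "m = (\<lambda>k. int (count (diff_mset P Q) k))"
  have bal: "balanced \<alpha> \<beta> m"
    using balanced_principal_pair[OF assms(1-3) PQ] unfolding \<alpha>_def \<beta>_def m_def .
  note D = balancedD[OF bal]
  define c where "c = count (parabolic_spectrum a b)"
  have c: "int (c k) = \<alpha> k + \<beta> k + m k - (if k = 0 then 1 else 0)" for k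
    using D(3) D(7)[of 1] unfolding c_def parabolic_spectrum_def PQ \<alpha>_def \<beta>_def m_def by (auto simp: of_nat_diff)
  have diff: "int (c (k + 1)) - int (c k) = m (- k) - m k" for k
    using D(12)[of "k + 1"] unfolding c by (simp split: if_splits)
  show ?thesis
  proof (rule central_pair_of_symmetric_decreasing[of c])
    fix k :: int
    have "int (c (1 - k)) = int (c k)"
      using D(12)[of k] D(1)[of "k - 1"] D(4)[of "k - 1"] unfolding c by (simp split: if_splits)
    then show "c (1 - k) = c k" by simp
    show "c (k + 1) < c k" if "1 \<le> k" "0 < c k"
      using diff[of k] D(13)[OF that(1)] c[of k] that by (simp split: if_splits)
    show "c (k + 1) = 0" if "1 \<le> k" "c k = 0"
    proof -
      have "m k = 0" "m (- k) \<le> m k" using c[of k] that D(7-9)[of k] D(11)[of "- k" k] by simp_all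
      then show ?thesis using diff[of k] that(2) D(9)[of "- k"] by simp
    qed
    show "count S (of_int k) = c k"
      unfolding S_def c_def by (rule count_image_inj) (simp add: inj_def)
  next
    show "0 < c 1" using c[of 1] D(7)[of 1] D(8)[of 1] D(10) by simp
    have "{k. 0 < c k} = set_mset (parabolic_spectrum a b)" unfolding c_def by auto
    then show "finite {k. 0 < c k}" by simp
    show "set_mset S \<subseteq> range of_int" unfolding S_def by auto
  qed
qed

section \<open>Block upper triangular matrices and weights of a functional\<close>

lemma mult_entry:
  assumes "x \<in> carrier_mat n m" "y \<in> carrier_mat m p" "i < n" "j < p"
  shows "(x * y) $$ (i, j) = (\<Sum>l<m. x $$ (i, l) * y $$ (l, j))"
  using assms by (simp add: scalar_prod_def lessThan_atLeast0)

lemma sum_lessThan_split: "(\<Sum>l<a + b. f l) = (\<Sum>l<a. f l) + (\<Sum>l<b. f (a + l))" for f :: "nat \<Rightarrow> 'a::comm_monoid_add"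
  by (induction b) (simp_all add: add.assoc)

text \<open>The block upper triangular matrices with diagonal blocks of sizes \<open>a\<close> and \<open>b\<close>, without a trace condition.\<close>

definition block_upper :: "nat \<Rightarrow> nat \<Rightarrow> complex mat set" where
  "block_upper a b = {x \<in> carrier_mat (a + b) (a + b). \<forall>i j. a \<le> i \<longrightarrow> i < a + b \<longrightarrow> j < a \<longrightarrow> x $$ (i, j) = 0}"

text \<open>The ideal of those block upper triangular matrices whose diagonal blocks are zero.  A functional
  \<open>x \<mapsto> tr (F x)\<close> on the block upper triangular matrices does not see this part of \<open>F\<close>.\<close>

definition upper_right :: "nat \<Rightarrow> nat \<Rightarrow> complex mat set" where
  "upper_right a b = {x \<in> carrier_mat (a + b) (a + b).
     \<forall>i j. i < a + b \<longrightarrow> j < a + b \<longrightarrow> \<not> (i < a \<and> a \<le> j) \<longrightarrow> x $$ (i, j) = 0}"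

definition upper_left_block :: "nat \<Rightarrow> complex mat \<Rightarrow> complex mat" where
  "upper_left_block a x = mat a a (\<lambda>(i, j). x $$ (i, j))"

definition upper_right_block :: "nat \<Rightarrow> nat \<Rightarrow> complex mat \<Rightarrow> complex mat" where
  "upper_right_block a b x = mat a b (\<lambda>(i, j). x $$ (i, a + j))"

definition lower_right_block :: "nat \<Rightarrow> nat \<Rightarrow> complex mat \<Rightarrow> complex mat" where
  "lower_right_block a b x = mat b b (\<lambda>(i, j). x $$ (a + i, a + j))"

lemma block_carrier [simp]:
  "upper_left_block a x \<in> carrier_mat a a"
  "upper_right_block a b x \<in> carrier_mat a b"
  "lower_right_block a b x \<in> carrier_mat b b"
  by (simp_all add: upper_left_block_def upper_right_block_def lower_right_block_def)

lemma block_upper_carrier: "x \<in> block_upper a b \<Longrightarrow> x \<in> carrier_mat (a + b) (a + b)"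
  by (simp add: block_upper_def)

lemma block_upper_zero: "x \<in> block_upper a b \<Longrightarrow> a \<le> i \<Longrightarrow> i < a + b \<Longrightarrow> j < a \<Longrightarrow> x $$ (i, j) = 0"
  by (simp add: block_upper_def)

lemma upper_right_carrier: "x \<in> upper_right a b \<Longrightarrow> x \<in> carrier_mat (a + b) (a + b)"
  by (simp add: upper_right_def)

lemma upper_right_zero:
  "x \<in> upper_right a b \<Longrightarrow> i < a + b \<Longrightarrow> j < a + b \<Longrightarrow> \<not> (i < a \<and> a \<le> j) \<Longrightarrow> x $$ (i, j) = 0"
  by (simp add: upper_right_def)

lemma block_upper_eq_four_block:
  assumes "x \<in> block_upper a b"
  shows "x = four_block_mat (upper_left_block a x) (upper_right_block a b x) (0\<^sub>m b a) (lower_right_block a b x)"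
  using block_upper_carrier[OF assms] block_upper_zero[OF assms]
  by (intro eq_matI) (auto simp: upper_left_block_def upper_right_block_def lower_right_block_def)

lemma four_block_in_block_upper:
  "X \<in> carrier_mat a a \<Longrightarrow> Z \<in> carrier_mat a b \<Longrightarrow> Y \<in> carrier_mat b b \<Longrightarrow>
     four_block_mat X Z (0\<^sub>m b a) Y \<in> block_upper a b"
  by (auto simp: block_upper_def)

lemma blocks_four_block:
  assumes "X \<in> carrier_mat a a" "Z \<in> carrier_mat a b" "Y \<in> carrier_mat b b"
  shows "upper_left_block a (four_block_mat X Z C Y) = X"
    "lower_right_block a b (four_block_mat X Z C Y) = Y"
  using assms by (auto simp: upper_left_block_def lower_right_block_def intro!: eq_matI)

lemma block_upper_mult:
  assumes x: "x \<in> block_upper a b" and y: "y \<in> block_upper a b"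
  shows "x * y \<in> block_upper a b"
    "upper_left_block a (x * y) = upper_left_block a x * upper_left_block a y"
    "lower_right_block a b (x * y) = lower_right_block a b x * lower_right_block a b y"
proof -
  note car = block_upper_carrier[OF x] block_upper_carrier[OF y]
  note zero = block_upper_zero[OF x] block_upper_zero[OF y]
  have entry: "(x * y) $$ (i, j) = (\<Sum>l<a. x $$ (i, l) * y $$ (l, j)) + (\<Sum>l<b. x $$ (i, a + l) * y $$ (a + l, j))"
    if "i < a + b" "j < a + b" for i j
    using mult_entry[OF car that] by (simp add: sum_lessThan_split)
  show "x * y \<in> block_upper a b"
    unfolding block_upper_def using car zero by (auto simp: entry simp del: index_mult_mat(1))
  show "upper_left_block a (x * y) = upper_left_block a x * upper_left_block a y"
    by (rule eq_matI)
      (use zero in \<open>auto simp: upper_left_block_def entry scalar_prod_def lessThan_atLeast0 simp del: index_mult_mat(1)\<close>,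
       simp add: index_mult_mat(1) scalar_prod_def)
  show "lower_right_block a b (x * y) = lower_right_block a b x * lower_right_block a b y"
    by (rule eq_matI)
      (use zero in \<open>auto simp: lower_right_block_def entry scalar_prod_def lessThan_atLeast0 simp del: index_mult_mat(1)\<close>,
       simp add: index_mult_mat(1) scalar_prod_def)
qed

lemma upper_right_ideal:
  assumes x: "x \<in> block_upper a b" and y: "y \<in> upper_right a b"
  shows "x * y \<in> upper_right a b" "y * x \<in> upper_right a b"
proof -
  note car = block_upper_carrier[OF x] upper_right_carrier[OF y]
  note zero = block_upper_zero[OF x] upper_right_zero[OF y]
  show "x * y \<in> upper_right a b"
    unfolding upper_right_def
  proof (clarify, intro conjI allI impI)
    fix i j assume ij: "i < a + b" "j < a + b" "\<not> (i < a \<and> a \<le> j)"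
    have "x $$ (i, l) * y $$ (l, j) = 0" if "l < a + b" for l
      using zero(1)[of i l] zero(2)[of l j] ij that by (cases "l < a") auto
    then show "(x * y) $$ (i, j) = 0" unfolding mult_entry[OF car ij(1,2)] by (intro sum.neutral) auto
  qed (use car in auto)
  show "y * x \<in> upper_right a b"
    unfolding upper_right_def
  proof (clarify, intro conjI allI impI)
    fix i j assume ij: "i < a + b" "j < a + b" "\<not> (i < a \<and> a \<le> j)"
    have "y $$ (i, l) * x $$ (l, j) = 0" if "l < a + b" for l
      using zero(1)[of l j] zero(2)[of i l] ij that by (cases "l < a") auto
    then show "(y * x) $$ (i, j) = 0" unfolding mult_entry[OF car(2,1) ij(1,2)] by (intro sum.neutral) auto
  qed (use car in auto)
qed

text \<open>With \<open>\<phi>(x) = tr (F x)\<close> one has \<open>\<phi>([h, x]) = tr ([F, h] x)\<close>.  So this predicate says that \<open>h\<close> scales the functional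
  of \<open>F\<close> by \<open>k\<close>: for \<open>k = 0\<close> it describes the radical of the associated form, for \<open>k = 1\<close> the principal elements, in
  both cases up to adding scalar matrices to \<open>h\<close>.\<close>

definition coadjoint_weight :: "nat \<Rightarrow> nat \<Rightarrow> complex mat \<Rightarrow> complex \<Rightarrow> complex mat \<Rightarrow> bool" where
  "coadjoint_weight a b F k h \<longleftrightarrow> h \<in> block_upper a b \<and> commutator F h - k \<cdot>\<^sub>m F \<in> upper_right a b"

text \<open>No trace condition is imposed here, hence scalar matrices always lie in the radical.\<close>

definition frobenius_matrix :: "nat \<Rightarrow> nat \<Rightarrow> complex mat \<Rightarrow> bool" where
  "frobenius_matrix a b F \<longleftrightarrow> F \<in> carrier_mat (a + b) (a + b) \<and>
     (\<forall>h. coadjoint_weight a b F 0 h \<longrightarrow> (\<exists>c. h = c \<cdot>\<^sub>m 1\<^sub>m (a + b)))"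

lemma commutator_carrier: "x \<in> carrier_mat n n \<Longrightarrow> y \<in> carrier_mat n n \<Longrightarrow> commutator x y \<in> carrier_mat n n"
  by (simp add: commutator_def minus_carrier_mat)

lemma commutator_conjugate:
  assumes car: "F \<in> carrier_mat n n" "h \<in> carrier_mat n n" "g \<in> carrier_mat n n" "g' \<in> carrier_mat n n"
    and inv: "g * g' = 1\<^sub>m n"
  shows "commutator (g' * F * g) (g' * h * g) = g' * commutator F h * g"
proof -
  note [simp] = assoc_mult_mat[of _ n n _ n _ n]
  have prod: "(g' * x * g) * (g' * y * g) = g' * (x * y) * g" if "x \<in> carrier_mat n n" "y \<in> carrier_mat n n" for x y
  proof -
    have "(g' * x * g) * (g' * y * g) = g' * (x * ((g * g') * (y * g)))" using car that by simp
    then show ?thesis using car that unfolding inv by simp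
  qed
  have "g' * (F * h - h * F) * g = (g' * (F * h) - g' * (h * F)) * g"
    using car by (subst mult_minus_distrib_mat[of _ n n _ n]) auto
  also have "\<dots> = g' * (F * h) * g - g' * (h * F) * g"
    using car by (subst minus_mult_distrib_mat[of _ n n _ _ n]) auto
  finally show ?thesis unfolding commutator_def using prod car by simp
qed

lemma coadjoint_weight_conjugate:
  assumes F: "F \<in> carrier_mat (a + b) (a + b)"
    and g: "g \<in> block_upper a b" and g': "g' \<in> block_upper a b" and inv: "g * g' = 1\<^sub>m (a + b)"
    and h: "coadjoint_weight a b F k h"
  shows "coadjoint_weight a b (g' * F * g) k (g' * h * g)"
proof -
  let ?n = "a + b"
  note gc = block_upper_carrier[OF g] block_upper_carrier[OF g']
  from h have hb: "h \<in> block_upper a b" and W: "commutator F h - k \<cdot>\<^sub>m F \<in> upper_right a b"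
    unfolding coadjoint_weight_def by auto
  note hc = block_upper_carrier[OF hb]
  have C: "commutator F h \<in> carrier_mat ?n ?n" by (rule commutator_carrier[OF F hc])
  have "g' * (commutator F h - k \<cdot>\<^sub>m F) * g = (g' * commutator F h - g' * (k \<cdot>\<^sub>m F)) * g"
    using gc C F by (subst mult_minus_distrib_mat[of _ ?n ?n _ ?n]) auto
  also have "\<dots> = g' * commutator F h * g - g' * (k \<cdot>\<^sub>m F) * g"
    using gc C F by (subst minus_mult_distrib_mat[of _ ?n ?n _ _ ?n]) auto
  also have "g' * (k \<cdot>\<^sub>m F) * g = k \<cdot>\<^sub>m (g' * F * g)"
    using gc F by (simp add: mult_smult_distrib[of _ ?n ?n _ ?n] mult_smult_assoc_mat[of _ ?n ?n _ ?n])
  also have "g' * commutator F h * g = commutator (g' * F * g) (g' * h * g)"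
    using commutator_conjugate[OF F hc gc inv] by simp
  finally have "commutator (g' * F * g) (g' * h * g) - k \<cdot>\<^sub>m (g' * F * g) = g' * (commutator F h - k \<cdot>\<^sub>m F) * g" by simp
  moreover have "g' * (commutator F h - k \<cdot>\<^sub>m F) * g \<in> upper_right a b"
    by (intro upper_right_ideal g g' W)
  ultimately show ?thesis
    unfolding coadjoint_weight_def using block_upper_mult(1) g g' hb by metis
qed

lemma frobenius_matrix_conjugate:
  assumes F: "frobenius_matrix a b F"
    and g: "g \<in> block_upper a b" and g': "g' \<in> block_upper a b"
    and inv: "g * g' = 1\<^sub>m (a + b)" "g' * g = 1\<^sub>m (a + b)"
  shows "frobenius_matrix a b (g' * F * g)"
proof -
  let ?n = "a + b"
  note gc = block_upper_carrier[OF g] block_upper_carrier[OF g']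
  note [simp] = assoc_mult_mat[of _ ?n ?n _ ?n _ ?n]
  have Fc: "F \<in> carrier_mat ?n ?n" using F unfolding frobenius_matrix_def by simp
  have conj_inv: "g * (g' * x * g) * g' = x" if "x \<in> carrier_mat ?n ?n" for x
  proof -
    have "g * (g' * x * g) * g' = (g * g') * x * (g * g')" using gc that by simp
    then show ?thesis using that unfolding inv by simp
  qed
  have conj_inv': "g' * (g * x * g') * g = x" if "x \<in> carrier_mat ?n ?n" for x
  proof -
    have "g' * (g * x * g') * g = (g' * g) * x * (g' * g)" using gc that by simp
    then show ?thesis using that unfolding inv by simp
  qed
  show ?thesis
    unfolding frobenius_matrix_def
  proof (intro conjI allI impI)
    show "g' * F * g \<in> carrier_mat ?n ?n" using gc Fc by auto
    fix h assume h: "coadjoint_weight a b (g' * F * g) 0 h"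
    then have hc: "h \<in> carrier_mat ?n ?n" unfolding coadjoint_weight_def by (auto dest: block_upper_carrier)
    have "coadjoint_weight a b (g * (g' * F * g) * g') 0 (g * h * g')"
      by (rule coadjoint_weight_conjugate[OF _ g' g inv(2) h]) (use gc Fc in auto)
    then obtain c where "g * h * g' = c \<cdot>\<^sub>m 1\<^sub>m ?n"
      using F unfolding conj_inv[OF Fc] frobenius_matrix_def by blast
    then have "h = g' * (c \<cdot>\<^sub>m 1\<^sub>m ?n) * g" using conj_inv'[OF hc] by simp
    also have "\<dots> = c \<cdot>\<^sub>m (g' * g)"
      using gc by (simp add: mult_smult_distrib[of _ ?n ?n _ ?n] mult_smult_assoc_mat[of _ ?n ?n _ ?n])
    finally show "\<exists>c. h = c \<cdot>\<^sub>m 1\<^sub>m ?n" using inv by auto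
  qed
qed

lemma block_char_poly_conjugate:
  assumes h: "h \<in> block_upper a b"
    and g: "g \<in> block_upper a b" and g': "g' \<in> block_upper a b"
    and inv: "g * g' = 1\<^sub>m (a + b)" "g' * g = 1\<^sub>m (a + b)"
  shows "char_poly (upper_left_block a (g' * h * g)) = char_poly (upper_left_block a h)"
    "char_poly (lower_right_block a b (g' * h * g)) = char_poly (lower_right_block a b h)"
proof -
  have one: "upper_left_block a (1\<^sub>m (a + b)) = 1\<^sub>m a" "lower_right_block a b (1\<^sub>m (a + b)) = 1\<^sub>m b"
    by (auto simp: upper_left_block_def lower_right_block_def intro!: eq_matI)
  note mult = block_upper_mult[OF g g', unfolded inv one] block_upper_mult[OF g' g, unfolded inv one]
  have "similar_mat (upper_left_block a (g' * h * g)) (upper_left_block a h)"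
  proof (rule similar_matI[of _ _ "upper_left_block a g'" "upper_left_block a g" a])
    show "upper_left_block a (g' * h * g) = upper_left_block a g' * upper_left_block a h * upper_left_block a g"
      using block_upper_mult[OF g' h] block_upper_mult[OF block_upper_mult(1)[OF g' h] g] by simp
  qed (use mult in simp_all)
  then show "char_poly (upper_left_block a (g' * h * g)) = char_poly (upper_left_block a h)"
    by (rule char_poly_similar)
  have "similar_mat (lower_right_block a b (g' * h * g)) (lower_right_block a b h)"
  proof (rule similar_matI[of _ _ "lower_right_block a b g'" "lower_right_block a b g" b])
    show "lower_right_block a b (g' * h * g) = lower_right_block a b g' * lower_right_block a b h * lower_right_block a b g"
      using block_upper_mult[OF g' h] block_upper_mult[OF block_upper_mult(1)[OF g' h] g] by simp
  qed (use mult in simp_all)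
  then show "char_poly (lower_right_block a b (g' * h * g)) = char_poly (lower_right_block a b h)"
    by (rule char_poly_similar)
qed

section \<open>Exchanging the two diagonal blocks\<close>

text \<open>Conjugating the negative transpose by the permutation that exchanges the two blocks gives an
  isomorphism from type \<open>(a, b)\<close> to type \<open>(b, a)\<close>.\<close>

definition swap_index :: "nat \<Rightarrow> nat \<Rightarrow> nat \<Rightarrow> nat" where
  "swap_index a b i = (if i < b then a + i else i - b)"

definition flip :: "nat \<Rightarrow> nat \<Rightarrow> complex mat \<Rightarrow> complex mat" where
  "flip a b x = mat (b + a) (b + a) (\<lambda>(i, j). - x $$ (swap_index a b j, swap_index a b i))"

lemma swap_index_less: "i < b + a \<Longrightarrow> swap_index a b i < a + b"
  by (auto simp: swap_index_def)

lemma swap_index_swap_index: "i < a + b \<Longrightarrow> swap_index a b (swap_index b a i) = i"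
  by (auto simp: swap_index_def)

lemma flip_carrier [simp]: "flip a b x \<in> carrier_mat (b + a) (b + a)"
  by (simp add: flip_def)

lemma flip_entry: "i < b + a \<Longrightarrow> j < b + a \<Longrightarrow> flip a b x $$ (i, j) = - x $$ (swap_index a b j, swap_index a b i)"
  by (simp add: flip_def)

lemma flip_flip: "x \<in> carrier_mat (a + b) (a + b) \<Longrightarrow> flip b a (flip a b x) = x"
  by (rule eq_matI) (simp_all add: flip_entry swap_index_less swap_index_swap_index, simp_all add: flip_def)

lemma sum_swap_index: "(\<Sum>l<b + a. f (swap_index a b l)) = (\<Sum>l<a + b. f l)" for f :: "nat \<Rightarrow> 'a::comm_monoid_add"
proof -
  have "(\<Sum>l<b + a. f (swap_index a b l)) = (\<Sum>l<b. f (a + l)) + (\<Sum>l<a. f l)"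
    unfolding sum_lessThan_split by (simp add: swap_index_def)
  then show ?thesis by (simp add: sum_lessThan_split add.commute)
qed

lemma flip_mult:
  assumes "x \<in> carrier_mat (a + b) (a + b)" "y \<in> carrier_mat (a + b) (a + b)"
  shows "flip a b x * flip a b y = - flip a b (y * x)"
proof (rule eq_matI)
  fix i j assume "i < dim_row (- flip a b (y * x))" "j < dim_col (- flip a b (y * x))"
  then have ij: "i < b + a" "j < b + a" by (simp_all add: flip_def)
  have "(flip a b x * flip a b y) $$ (i, j)
      = (\<Sum>l<b + a. x $$ (swap_index a b l, swap_index a b i) * y $$ (swap_index a b j, swap_index a b l))"
    using mult_entry[OF flip_carrier flip_carrier ij] ij by (simp add: flip_entry)
  also have "\<dots> = (\<Sum>l<a + b. x $$ (l, swap_index a b i) * y $$ (swap_index a b j, l))"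
    by (rule sum_swap_index)
  also have "\<dots> = (- flip a b (y * x)) $$ (i, j)"
    using mult_entry[OF assms(2,1) swap_index_less[OF ij(2)] swap_index_less[OF ij(1)]] ij
    by (simp add: flip_def mult.commute)
  finally show "(flip a b x * flip a b y) $$ (i, j) = (- flip a b (y * x)) $$ (i, j)" .
qed (simp_all add: flip_def)

lemma flip_commutator:
  assumes x: "x \<in> carrier_mat (a + b) (a + b)" and y: "y \<in> carrier_mat (a + b) (a + b)"
  shows "commutator (flip a b x) (flip a b y) = flip a b (commutator x y)"
  unfolding commutator_def flip_mult[OF x y] flip_mult[OF y x]
  using x y by (intro eq_matI) (simp_all add: flip_def swap_index_less)

lemma flip_block_upper: "x \<in> block_upper a b \<Longrightarrow> flip a b x \<in> block_upper b a"
  by (auto simp: block_upper_def flip_entry swap_index_def)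

lemma flip_upper_right: "x \<in> upper_right a b \<Longrightarrow> flip a b x \<in> upper_right b a"
proof -
  assume x: "x \<in> upper_right a b"
  have "x $$ (swap_index a b j, swap_index a b i) = 0"
    if "i < b + a" "j < b + a" "\<not> (i < b \<and> b \<le> j)" for i j
    by (rule upper_right_zero[OF x]) (use that in \<open>auto simp: swap_index_def\<close>)
  then show ?thesis by (simp add: upper_right_def flip_entry)
qed

lemma coadjoint_weight_flip:
  assumes F: "F \<in> carrier_mat (a + b) (a + b)" and h: "coadjoint_weight a b F k h"
  shows "coadjoint_weight b a (flip a b F) k (flip a b h)"
proof -
  from h have hb: "h \<in> block_upper a b" and W: "commutator F h - k \<cdot>\<^sub>m F \<in> upper_right a b"
    unfolding coadjoint_weight_def by auto
  note hc = block_upper_carrier[OF hb]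
  have "commutator (flip a b F) (flip a b h) - k \<cdot>\<^sub>m flip a b F = flip a b (commutator F h - k \<cdot>\<^sub>m F)"
    unfolding flip_commutator[OF F hc] using F commutator_carrier[OF F hc]
    by (intro eq_matI) (simp_all add: flip_def swap_index_less)
  then show ?thesis
    unfolding coadjoint_weight_def using flip_block_upper[OF hb] flip_upper_right[OF W] by simp
qed

lemma frobenius_matrix_flip:
  assumes F: "frobenius_matrix a b F"
  shows "frobenius_matrix b a (flip a b F)"
  unfolding frobenius_matrix_def
proof (intro conjI allI impI)
  have Fc: "F \<in> carrier_mat (a + b) (a + b)" using F unfolding frobenius_matrix_def by simp
  fix h assume h: "coadjoint_weight b a (flip a b F) 0 h"
  then have hc: "h \<in> carrier_mat (b + a) (b + a)" unfolding coadjoint_weight_def by (auto dest: block_upper_carrier)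
  have "coadjoint_weight a b F 0 (flip b a h)"
    using coadjoint_weight_flip[OF _ h] unfolding flip_flip[OF Fc] by simp
  then obtain c where c: "flip b a h = c \<cdot>\<^sub>m 1\<^sub>m (a + b)" using F unfolding frobenius_matrix_def by blast
  have "h = flip a b (c \<cdot>\<^sub>m 1\<^sub>m (a + b))" using flip_flip[OF hc] unfolding c by simp
  also have "\<dots> = (- c) \<cdot>\<^sub>m 1\<^sub>m (b + a)"
    by (rule eq_matI) (auto simp: flip_def swap_index_def)
  finally show "\<exists>c. h = c \<cdot>\<^sub>m 1\<^sub>m (b + a)" by blast
qed simp

lemma flip_blocks:
  "upper_left_block b (flip a b x) = - (lower_right_block a b x)\<^sup>T"
  "lower_right_block b a (flip a b x) = - (upper_left_block a x)\<^sup>T"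
  by (auto simp: upper_left_block_def lower_right_block_def flip_entry swap_index_def intro!: eq_matI)

section \<open>Roots of characteristic polynomials\<close>

lemma proots_linear_factors: "proots (\<Prod>e\<leftarrow>es. [:- e, 1:]) = mset (es :: complex list)"
proof (induction es)
  case (Cons e es)
  have "(\<Prod>e\<leftarrow>es. [:- e, 1:]) \<noteq> (0 :: complex poly)" by (auto simp: prod_list_zero_iff)
  then have "proots ([:- e, 1:] * (\<Prod>e\<leftarrow>es. [:- e, 1:])) = add_mset e (mset es)"
    using Cons by (subst proots_mult) auto
  then show ?case unfolding list.map prod_list.Cons mset.simps .
qed simp

lemma proots_char_poly_upper_triangular:
  assumes "(M :: complex mat) \<in> carrier_mat n n" "upper_triangular M"
  shows "proots (char_poly M) = mset (diag_mat M)"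
  using char_poly_upper_triangular[OF assms] by (simp add: proots_linear_factors)

lemma complex_schur:
  assumes A: "(A :: complex mat) \<in> carrier_mat n n"
  obtains B P Q where "upper_triangular B" "similar_mat_wit A B P Q"
    "proots (char_poly A) = mset (diag_mat B)"
proof -
  obtain es where "char_poly A = (\<Prod>e\<leftarrow>es. [:- e, 1:])" using char_poly_factorized[OF A] by blast
  then obtain B where B: "B \<in> carrier_mat n n" "upper_triangular B" "similar_mat A B"
    using schur_decomposition_exists[OF A] by blast
  then obtain P Q where "similar_mat_wit A B P Q" unfolding similar_mat_def by blast
  moreover have "proots (char_poly A) = mset (diag_mat B)"
    using proots_char_poly_upper_triangular[OF B(1,2)] char_poly_similar[OF B(3)] by simp
  ultimately show ?thesis using that B by blast
qed

lemma proots_char_poly_affine: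
  assumes A: "(A :: complex mat) \<in> carrier_mat n n"
  shows "proots (char_poly (c \<cdot>\<^sub>m A + k \<cdot>\<^sub>m 1\<^sub>m n)) = image_mset (\<lambda>x. c * x + k) (proots (char_poly A))"
proof -
  obtain B P Q where B: "upper_triangular B" "similar_mat_wit A B P Q" "proots (char_poly A) = mset (diag_mat B)"
    using complex_schur[OF A] by blast
  note D = similar_mat_witD2[OF A B(2)]
  have "similar_mat (c \<cdot>\<^sub>m A + k \<cdot>\<^sub>m 1\<^sub>m n) (c \<cdot>\<^sub>m B + k \<cdot>\<^sub>m 1\<^sub>m n)"
  proof (rule similar_matI[of _ _ P Q n])
    have "P * (c \<cdot>\<^sub>m B + k \<cdot>\<^sub>m 1\<^sub>m n) * Q = c \<cdot>\<^sub>m (P * B * Q) + k \<cdot>\<^sub>m (P * Q)"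
      using D(5-7)
      by (simp add: mult_add_distrib_mat[of _ n n _ n] add_mult_distrib_mat[of _ n n _ _ n]
          mult_smult_distrib[of _ n n _ n] mult_smult_assoc_mat[of _ n n _ n])
    then show "c \<cdot>\<^sub>m A + k \<cdot>\<^sub>m 1\<^sub>m n = P * (c \<cdot>\<^sub>m B + k \<cdot>\<^sub>m 1\<^sub>m n) * Q" using D by simp
  qed (use D in auto)
  then have "proots (char_poly (c \<cdot>\<^sub>m A + k \<cdot>\<^sub>m 1\<^sub>m n)) = proots (char_poly (c \<cdot>\<^sub>m B + k \<cdot>\<^sub>m 1\<^sub>m n))"
    by (metis char_poly_similar)
  also have "\<dots> = mset (diag_mat (c \<cdot>\<^sub>m B + k \<cdot>\<^sub>m 1\<^sub>m n))"
    using B D by (intro proots_char_poly_upper_triangular[of _ n]) (auto simp: upper_triangular_def)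
  also have "\<dots> = image_mset (\<lambda>x. c * x + k) (mset (diag_mat B))"
    using D(5) unfolding diag_mat_def mset_map[symmetric] by (intro arg_cong[of _ _ mset]) auto
  finally show ?thesis unfolding B(3) .
qed

lemma proots_char_poly_neg_transpose:
  assumes A: "(A :: complex mat) \<in> carrier_mat n n"
  shows "proots (char_poly (- A\<^sup>T)) = image_mset uminus (proots (char_poly A))"
proof -
  have "- A\<^sup>T = (-1) \<cdot>\<^sub>m A\<^sup>T + 0 \<cdot>\<^sub>m 1\<^sub>m n" using A by (intro eq_matI) auto
  then show ?thesis using proots_char_poly_affine[of "A\<^sup>T" n "-1" 0] A by simp
qed

lemma proots_char_poly_block_upper:
  assumes h: "h \<in> block_upper a b"
  shows "proots (char_poly h) = proots (char_poly (upper_left_block a h)) + proots (char_poly (lower_right_block a b h))"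
proof -
  have "char_poly h = char_poly (upper_left_block a h) * char_poly (lower_right_block a b h)"
    by (rule char_poly_0_block[OF block_upper_eq_four_block[OF h]])
      (use char_poly_factorized[OF block_carrier(1)[of a h]] char_poly_factorized[OF block_carrier(3)[of a b h]] in auto)
  moreover have "char_poly M \<noteq> 0" if "M \<in> carrier_mat m m" for M :: "complex mat" and m
    using degree_monic_char_poly[OF that] by auto
  then have "char_poly (upper_left_block a h) \<noteq> 0" "char_poly (lower_right_block a b h) \<noteq> 0"
    by (blast intro: block_carrier)+
  ultimately show ?thesis by (simp add: proots_mult)
qed

section \<open>Functionals in normal form\<close>

lemma four_block_in_upper_right_iff:
  assumes "A \<in> carrier_mat a a" "B \<in> carrier_mat a b" "C \<in> carrier_mat b a" "D \<in> carrier_mat b b"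
  shows "four_block_mat A B C D \<in> upper_right a b \<longleftrightarrow> A = 0\<^sub>m a a \<and> C = 0\<^sub>m b a \<and> D = 0\<^sub>m b b"
proof
  assume U: "four_block_mat A B C D \<in> upper_right a b"
  note zero = upper_right_zero[OF U]
  show "A = 0\<^sub>m a a \<and> C = 0\<^sub>m b a \<and> D = 0\<^sub>m b b"
  proof (intro conjI eq_matI)
    fix i j assume ij: "i < dim_row (0\<^sub>m a a :: complex mat)" "j < dim_col (0\<^sub>m a a :: complex mat)"
    then show "A $$ (i, j) = 0\<^sub>m a a $$ (i, j)" using zero[of i j] assms by simp
  next
    fix i j assume ij: "i < dim_row (0\<^sub>m b a :: complex mat)" "j < dim_col (0\<^sub>m b a :: complex mat)"
    then show "C $$ (i, j) = 0\<^sub>m b a $$ (i, j)" using zero[of "a + i" j] assms by simp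
  next
    fix i j assume ij: "i < dim_row (0\<^sub>m b b :: complex mat)" "j < dim_col (0\<^sub>m b b :: complex mat)"
    then show "D $$ (i, j) = 0\<^sub>m b b $$ (i, j)" using zero[of "a + i" "a + j"] assms by simp
  qed (use assms in auto)
next
  assume "A = 0\<^sub>m a a \<and> C = 0\<^sub>m b a \<and> D = 0\<^sub>m b b"
  then show "four_block_mat A B C D \<in> upper_right a b" using assms by (auto simp: upper_right_def)
qed

text \<open>The matrix of the inclusion of \<open>\<complex>\<^sup>a\<close> into \<open>\<complex>\<^sup>n\<close> as the first \<open>a\<close> coordinates.\<close>

definition inclusion :: "nat \<Rightarrow> nat \<Rightarrow> complex mat" where
  "inclusion n a = mat n a (\<lambda>(i, j). if i = j then 1 else 0)"

lemma inclusion_carrier [simp]: "inclusion n a \<in> carrier_mat n a"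
  by (simp add: inclusion_def)

lemma inclusion_dim [simp]: "dim_row (inclusion n a) = n" "dim_col (inclusion n a) = a"
  by (simp_all add: inclusion_def)

lemma inclusion_mult:
  assumes "X \<in> carrier_mat a m" "i < n" "j < m"
  shows "(inclusion n a * X) $$ (i, j) = (if i < a then X $$ (i, j) else 0)"
proof -
  have "(inclusion n a * X) $$ (i, j) = (\<Sum>l<a. if l = i then X $$ (l, j) else 0)"
    unfolding mult_entry[OF inclusion_carrier assms]
    by (intro sum.cong) (use assms in \<open>auto simp: inclusion_def\<close>)
  then show ?thesis by simp
qed

lemma mult_inclusion:
  assumes "X \<in> carrier_mat m n" "a \<le> n" "i < m" "j < a"
  shows "(X * inclusion n a) $$ (i, j) = X $$ (i, j)"
proof -
  have "(X * inclusion n a) $$ (i, j) = (\<Sum>l<n. if l = j then X $$ (i, l) else 0)"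
    unfolding mult_entry[OF assms(1) inclusion_carrier assms(3,4)]
    by (intro sum.cong) (use assms in \<open>auto simp: inclusion_def\<close>)
  then show ?thesis using assms by simp
qed

text \<open>The three conditions are the upper left, lower left and lower right blocks of \<open>[F, h] - k F\<close>.\<close>

lemma coadjoint_weight_normal_form:
  assumes B: "B \<in> carrier_mat a n" and F: "F \<in> carrier_mat n n"
    and X: "X \<in> carrier_mat a a" and Z: "Z \<in> carrier_mat a n" and Y: "Y \<in> carrier_mat n n"
  shows "coadjoint_weight a n (four_block_mat (0\<^sub>m a a) B (inclusion n a) F) k (four_block_mat X Z (0\<^sub>m n a) Y)
    \<longleftrightarrow> Z * inclusion n a = 0\<^sub>m a a \<and> inclusion n a * X - Y * inclusion n a = k \<cdot>\<^sub>m inclusion n a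
      \<and> inclusion n a * Z + (commutator F Y - k \<cdot>\<^sub>m F) = 0\<^sub>m n n"
proof -
  let ?J = "inclusion n a"
  let ?N = "four_block_mat (0\<^sub>m a a) B ?J F" and ?h = "four_block_mat X Z (0\<^sub>m n a) Y"
  have Nh: "?N * ?h = four_block_mat (0\<^sub>m a a) (B * Y) (?J * X) (?J * Z + F * Y)"
    by (subst mult_four_block_mat[of _ a a _ n _ n]) (use assms in auto)
  have hN: "?h * ?N = four_block_mat (Z * ?J) (X * B + Z * F) (Y * ?J) (Y * F)"
    by (subst mult_four_block_mat[of _ a a _ n _ n]) (use assms in auto)
  have comm: "commutator ?N ?h - k \<cdot>\<^sub>m ?N = four_block_mat (0\<^sub>m a a - Z * ?J - k \<cdot>\<^sub>m 0\<^sub>m a a)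
      (B * Y - (X * B + Z * F) - k \<cdot>\<^sub>m B) (?J * X - Y * ?J - k \<cdot>\<^sub>m ?J) (?J * Z + F * Y - Y * F - k \<cdot>\<^sub>m F)"
    unfolding commutator_def Nh hN
    by (rule eq_matI) (use assms in \<open>auto simp del: index_mult_mat(1)\<close>)
  have "commutator ?N ?h - k \<cdot>\<^sub>m ?N \<in> upper_right a n \<longleftrightarrow>
      0\<^sub>m a a - Z * ?J - k \<cdot>\<^sub>m 0\<^sub>m a a = 0\<^sub>m a a \<and> ?J * X - Y * ?J - k \<cdot>\<^sub>m ?J = 0\<^sub>m n a
      \<and> ?J * Z + F * Y - Y * F - k \<cdot>\<^sub>m F = 0\<^sub>m n n"
    unfolding comm by (rule four_block_in_upper_right_iff) (use assms in \<open>auto intro!: minus_carrier_mat\<close>)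
  also have "0\<^sub>m a a - Z * ?J - k \<cdot>\<^sub>m 0\<^sub>m a a = 0\<^sub>m a a \<longleftrightarrow> Z * ?J = 0\<^sub>m a a"
    using assms by (auto simp: mat_eq_iff simp del: index_mult_mat(1))
  also have "?J * X - Y * ?J - k \<cdot>\<^sub>m ?J = 0\<^sub>m n a \<longleftrightarrow> ?J * X - Y * ?J = k \<cdot>\<^sub>m ?J"
    using assms by (auto simp: mat_eq_iff simp del: index_mult_mat(1))
  also have "?J * Z + F * Y - Y * F - k \<cdot>\<^sub>m F = ?J * Z + (commutator F Y - k \<cdot>\<^sub>m F)"
    unfolding commutator_def using assms by (intro eq_matI) (auto simp del: index_mult_mat(1))
  finally show ?thesis
    unfolding coadjoint_weight_def using four_block_in_block_upper[OF X Z Y] by simp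
qed

text \<open>The lower right block of a weight element for a functional in normal form is a weight element for
  the smaller functional, and it determines the other blocks.\<close>

lemma normal_form_reduce:
  assumes B: "B \<in> carrier_mat a (a + b)" and F: "F \<in> carrier_mat (a + b) (a + b)"
    and X: "X \<in> carrier_mat a a" and Z: "Z \<in> carrier_mat a (a + b)" and Y: "Y \<in> carrier_mat (a + b) (a + b)"
    and w: "coadjoint_weight a (a + b) (four_block_mat (0\<^sub>m a a) B (inclusion (a + b) a) F) k
              (four_block_mat X Z (0\<^sub>m (a + b) a) Y)"
  shows "coadjoint_weight a b F k Y" "X = upper_left_block a Y + k \<cdot>\<^sub>m 1\<^sub>m a"
    "\<And>i j. i < a \<Longrightarrow> j < a + b \<Longrightarrow> Z $$ (i, j) = - (commutator F Y - k \<cdot>\<^sub>m F) $$ (i, j)"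
proof -
  let ?J = "inclusion (a + b) a" and ?W = "commutator F Y - k \<cdot>\<^sub>m F"
  have eqs: "Z * ?J = 0\<^sub>m a a" "?J * X - Y * ?J = k \<cdot>\<^sub>m ?J" "?J * Z + ?W = 0\<^sub>m (a + b) (a + b)"
    using w coadjoint_weight_normal_form[OF B F X Z Y] by blast+
  have Wc: "?W \<in> carrier_mat (a + b) (a + b)" using F by (intro minus_carrier_mat) auto
  have z: "Z $$ (i, j) = 0" if "i < a" "j < a" for i j
    using arg_cong[OF eqs(1), of "\<lambda>M. M $$ (i, j)"] mult_inclusion[OF Z _ that] that by simp
  have y: "(if i < a then X $$ (i, j) else 0) - Y $$ (i, j) = (if i = j then k else 0)" if "i < a + b" "j < a" for i j
    using arg_cong[OF eqs(2), of "\<lambda>M. M $$ (i, j)"] mult_inclusion[OF Y _ that] inclusion_mult[OF X that] that X Y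
    by (simp add: inclusion_def del: index_mult_mat(1))
  have v: "(if i < a then Z $$ (i, j) else 0) + ?W $$ (i, j) = 0" if "i < a + b" "j < a + b" for i j
  proof -
    have "(?J * Z + ?W) $$ (i, j) = (?J * Z) $$ (i, j) + ?W $$ (i, j)"
      using that Wc by (intro index_add_mat(1)) auto
    then show ?thesis using inclusion_mult[OF Z that] that unfolding eqs(3) by simp
  qed
  have "Y \<in> block_upper a b" unfolding block_upper_def using y Y by force
  moreover have "?W \<in> upper_right a b"
    unfolding upper_right_def
  proof (clarify, intro conjI allI impI)
    fix i j assume ij: "i < a + b" "j < a + b" "\<not> (i < a \<and> a \<le> j)"
    then show "?W $$ (i, j) = 0" using v[of i j] z[of i j] by (cases "i < a") (simp_all del: index_minus_mat(1))
  qed (rule Wc)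
  ultimately show "coadjoint_weight a b F k Y" unfolding coadjoint_weight_def by blast
  show "X = upper_left_block a Y + k \<cdot>\<^sub>m 1\<^sub>m a"
  proof (rule eq_matI)
    fix i j assume "i < dim_row (upper_left_block a Y + k \<cdot>\<^sub>m 1\<^sub>m a)" "j < dim_col (upper_left_block a Y + k \<cdot>\<^sub>m 1\<^sub>m a)"
    then show "X $$ (i, j) = (upper_left_block a Y + k \<cdot>\<^sub>m 1\<^sub>m a) $$ (i, j)"
      using y[of i j] by (auto simp: upper_left_block_def algebra_simps split: if_splits)
  qed (use X in auto)
  show "Z $$ (i, j) = - ?W $$ (i, j)" if "i < a" "j < a + b" for i j
    using v[of i j] that by (simp add: eq_neg_iff_add_eq_0 del: index_minus_mat(1))
qed

text \<open>Conversely, every weight element for the smaller functional arises in this way.\<close>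

lemma normal_form_extend:
  assumes B: "B \<in> carrier_mat a (a + b)" and F: "F \<in> carrier_mat (a + b) (a + b)"
    and w: "coadjoint_weight a b F k Y"
  obtains Z where "Z \<in> carrier_mat a (a + b)"
    "coadjoint_weight a (a + b) (four_block_mat (0\<^sub>m a a) B (inclusion (a + b) a) F) k
       (four_block_mat (upper_left_block a Y + k \<cdot>\<^sub>m 1\<^sub>m a) Z (0\<^sub>m (a + b) a) Y)"
proof -
  let ?J = "inclusion (a + b) a" and ?W = "commutator F Y - k \<cdot>\<^sub>m F"
  let ?X = "upper_left_block a Y + k \<cdot>\<^sub>m 1\<^sub>m a"
  define Z where "Z = mat a (a + b) (\<lambda>(i, j). - ?W $$ (i, j))"
  have Yb: "Y \<in> block_upper a b" and W: "?W \<in> upper_right a b" using w unfolding coadjoint_weight_def by auto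
  note Y = block_upper_carrier[OF Yb] and Wc = upper_right_carrier[OF W]
  have X: "?X \<in> carrier_mat a a" and Z: "Z \<in> carrier_mat a (a + b)" by (simp_all add: Z_def)
  have "Z * ?J = 0\<^sub>m a a"
  proof (rule eq_matI)
    fix i j assume ij: "i < dim_row (0\<^sub>m a a :: complex mat)" "j < dim_col (0\<^sub>m a a :: complex mat)"
    have "(Z * ?J) $$ (i, j) = Z $$ (i, j)" using ij by (intro mult_inclusion[OF Z]) auto
    also have "\<dots> = - ?W $$ (i, j)" using ij by (simp add: Z_def)
    also have "\<dots> = 0" using ij upper_right_zero[OF W, of i j] by (simp del: index_minus_mat(1))
    finally show "(Z * ?J) $$ (i, j) = 0\<^sub>m a a $$ (i, j)" using ij by simp
  qed (use Z in auto)
  moreover have "?J * ?X - Y * ?J = k \<cdot>\<^sub>m ?J"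
  proof (rule eq_matI)
    fix i j assume "i < dim_row (k \<cdot>\<^sub>m ?J)" "j < dim_col (k \<cdot>\<^sub>m ?J)"
    then have ij: "i < a + b" "j < a" by (auto simp: inclusion_def)
    show "(?J * ?X - Y * ?J) $$ (i, j) = (k \<cdot>\<^sub>m ?J) $$ (i, j)"
      using ij Y block_upper_zero[OF Yb, of i j] inclusion_mult[OF X ij] mult_inclusion[OF Y _ ij]
      by (auto simp: upper_left_block_def inclusion_def simp del: index_mult_mat(1))
  qed (use X Y in auto)
  moreover have "?J * Z + ?W = 0\<^sub>m (a + b) (a + b)"
  proof (rule eq_matI)
    fix i j assume "i < dim_row (0\<^sub>m (a + b) (a + b) :: complex mat)" "j < dim_col (0\<^sub>m (a + b) (a + b) :: complex mat)"
    then have ij: "i < a + b" "j < a + b" by auto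
    have "(?J * Z + ?W) $$ (i, j) = (?J * Z) $$ (i, j) + ?W $$ (i, j)"
      using ij Wc by (intro index_add_mat(1)) auto
    also have "\<dots> = 0"
      using inclusion_mult[OF Z ij] upper_right_zero[OF W ij] ij by (auto simp: Z_def simp del: index_minus_mat(1))
    finally show "(?J * Z + ?W) $$ (i, j) = 0\<^sub>m (a + b) (a + b) $$ (i, j)" using ij by simp
  qed (use Wc in auto)
  ultimately show ?thesis using that[OF Z] coadjoint_weight_normal_form[OF B F X Z Y] by blast
qed

lemma frobenius_matrix_normal_form:
  assumes B: "B \<in> carrier_mat a (a + b)" and F: "F \<in> carrier_mat (a + b) (a + b)"
  shows "frobenius_matrix a (a + b) (four_block_mat (0\<^sub>m a a) B (inclusion (a + b) a) F) \<longleftrightarrow> frobenius_matrix a b F"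
    (is "frobenius_matrix _ _ ?N \<longleftrightarrow> _")
proof
  assume N: "frobenius_matrix a (a + b) ?N"
  show "frobenius_matrix a b F"
    unfolding frobenius_matrix_def
  proof (intro conjI allI impI)
    fix Y assume w: "coadjoint_weight a b F 0 Y"
    then have Y: "Y \<in> carrier_mat (a + b) (a + b)" unfolding coadjoint_weight_def by (auto dest: block_upper_carrier)
    obtain Z where Z: "Z \<in> carrier_mat a (a + b)" and
      "coadjoint_weight a (a + b) ?N 0 (four_block_mat (upper_left_block a Y + 0 \<cdot>\<^sub>m 1\<^sub>m a) Z (0\<^sub>m (a + b) a) Y)"
      using normal_form_extend[OF B F w] by blast
    then obtain c where c: "four_block_mat (upper_left_block a Y + 0 \<cdot>\<^sub>m 1\<^sub>m a) Z (0\<^sub>m (a + b) a) Y = c \<cdot>\<^sub>m 1\<^sub>m (a + (a + b))"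
      using N unfolding frobenius_matrix_def by blast
    have "Y = lower_right_block a (a + b) (c \<cdot>\<^sub>m 1\<^sub>m (a + (a + b)))"
      unfolding c[symmetric] using Y Z by (subst blocks_four_block(2)[of _ a _ "a + b"]) auto
    also have "\<dots> = c \<cdot>\<^sub>m 1\<^sub>m (a + b)" by (rule eq_matI) (auto simp: lower_right_block_def)
    finally show "\<exists>c. Y = c \<cdot>\<^sub>m 1\<^sub>m (a + b)" by blast
  qed (use F in auto)
next
  assume Fr: "frobenius_matrix a b F"
  show "frobenius_matrix a (a + b) ?N"
    unfolding frobenius_matrix_def
  proof (intro conjI allI impI)
    show "?N \<in> carrier_mat (a + (a + b)) (a + (a + b))" using F by auto
    fix h assume w: "coadjoint_weight a (a + b) ?N 0 h"
    define X Z Y where "X = upper_left_block a h" and "Z = upper_right_block a (a + b) h"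
      and "Y = lower_right_block a (a + b) h"
    have h: "h = four_block_mat X Z (0\<^sub>m (a + b) a) Y"
      unfolding X_def Y_def Z_def using w unfolding coadjoint_weight_def
      by (intro block_upper_eq_four_block) blast
    have car: "X \<in> carrier_mat a a" "Z \<in> carrier_mat a (a + b)" "Y \<in> carrier_mat (a + b) (a + b)"
      unfolding X_def Y_def Z_def by auto
    note red = normal_form_reduce[OF B F car w[unfolded h]]
    obtain c where c: "Y = c \<cdot>\<^sub>m 1\<^sub>m (a + b)" using Fr red(1) unfolding frobenius_matrix_def by blast
    have "commutator F Y - 0 \<cdot>\<^sub>m F = 0\<^sub>m (a + b) (a + b)"
      unfolding commutator_def c using F
      by (simp add: mult_smult_distrib[of _ "a + b" "a + b" _ "a + b"] mult_smult_assoc_mat[of _ "a + b" "a + b" _ "a + b"])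
        (auto intro!: eq_matI)
    then have "Z = 0\<^sub>m a (a + b)" using red(3) car(2) by (intro eq_matI) auto
    moreover have "X = c \<cdot>\<^sub>m 1\<^sub>m a" unfolding red(2) c by (rule eq_matI) (auto simp: upper_left_block_def)
    ultimately have "h = c \<cdot>\<^sub>m 1\<^sub>m (a + (a + b))" unfolding h c by (intro eq_matI) auto
    then show "\<exists>c. h = c \<cdot>\<^sub>m 1\<^sub>m (a + (a + b))" by blast
  qed
qed

section \<open>Reduction of Frobenius functionals to normal form\<close>

text \<open>An injective matrix becomes the inclusion after row operations: its reduced row echelon form has a
  pivot in every column.\<close>

lemma injective_equivalent_inclusion:
  fixes C :: "complex mat"
  assumes C: "C \<in> carrier_mat n a" and an: "a \<le> n"
    and inj: "\<And>u. u \<in> carrier_vec a \<Longrightarrow> C *\<^sub>v u = 0\<^sub>v n \<Longrightarrow> u = 0\<^sub>v a"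
  obtains P Q where "P \<in> carrier_mat n n" "Q \<in> carrier_mat n n" "P * Q = 1\<^sub>m n" "Q * P = 1\<^sub>m n"
    "P * C = inclusion n a"
proof -
  define E where "E = gauss_jordan_single C"
  note gj = gauss_jordan_single[OF C E_def[symmetric]]
  obtain f where piv: "pivot_fun E f a" using gj(2,3) unfolding row_echelon_form_def by auto
  note D = pivot_funD[OF carrier_matD(1)[OF gj(2)] piv]
  have mono: "f i \<le> f (i + k)" if "i + k < n" for i k
    using that
  proof (induction k)
    case (Suc k)
    then show ?case using D(3)[of "i + k"] D(1)[of "i + k"] D(1)[of i] by fastforce
  qed simp
  have pivots: "f i = i" if "i < a" for i
    using that
  proof (induction i rule: less_induct)
    case (less i)
    show ?case
    proof (rule ccontr)
      assume neq: "f i \<noteq> i"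
      have "i \<le> f i"
      proof (cases i)
        case (Suc k)
        then show ?thesis using less.IH[of k] D(3)[of k] less.prems an by fastforce
      qed simp
      then have fi: "i < f i" using neq by simp
      \<comment> \<open>Column \<open>i\<close> has no pivot, hence it depends on the columns before it.\<close>
      define u where "u = vec a (\<lambda>l. if l = i then 1 else if l < i then - E $$ (l, i) else 0)"
      have col: "E $$ (r, l) = (if r = l then 1 else 0)" if "l < i" "r < n" for r l
        using D(4)[of l] D(5)[of l r] less.IH[OF that(1)] less.prems that an by auto
      have "E *\<^sub>v u = 0\<^sub>v n"
      proof (rule eq_vecI)
        fix r assume "r < dim_vec (0\<^sub>v n :: complex vec)"
        then have r: "r < n" by simp
        have "(E *\<^sub>v u) $ r = (\<Sum>l<a. E $$ (r, l) * (if l = i then 1 else if l < i then - E $$ (l, i) else 0))"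
          using r gj(2) by (simp add: u_def scalar_prod_def lessThan_atLeast0)
        also have "\<dots> = (\<Sum>l<a. (if l = i then E $$ (r, i) else 0) + (if l = r then (if r < i then - E $$ (r, i) else 0) else 0))"
          by (rule sum.cong) (use col r in auto)
        also have "\<dots> = E $$ (r, i) + (if r < i then - E $$ (r, i) else 0)"
          using less.prems by (auto simp: sum.distrib)
        also have "\<dots> = 0"
          using D(2)[OF r, of i] mono[of i "r - i"] fi r by (cases "r < i") auto
        finally show "(E *\<^sub>v u) $ r = 0\<^sub>v n $ r" using r by simp
      qed (use gj(2) in auto)
      then have "u = 0\<^sub>v a" using gj(1)[of u] by (intro inj) (auto simp: u_def)
      then have "u $ i = 0" using less.prems by simp
      then show False using less.prems by (simp add: u_def)
    qed
  qed
  have "E = inclusion n a"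
  proof (rule eq_matI)
    fix r l assume "r < dim_row (inclusion n a)" "l < dim_col (inclusion n a)"
    then show "E $$ (r, l) = inclusion n a $$ (r, l)"
      using D(4)[of l] D(5)[of l r] pivots[of l] an by (auto simp: inclusion_def)
  qed (use gj(2) in auto)
  moreover obtain P Q where "E = P * C" "P \<in> carrier_mat n n" "Q \<in> carrier_mat n n"
    "P * Q = 1\<^sub>m n" "Q * P = 1\<^sub>m n"
    using gj(4) by metis
  ultimately show ?thesis using that[of P Q] by simp
qed

text \<open>A matrix with at least as many rows as columns and a nonzero kernel has a transpose with nonzero kernel:
  padding with zero columns makes it square, so that determinants apply.\<close>

lemma singular_transpose:
  fixes C :: "complex mat"
  assumes C: "C \<in> carrier_mat n a" and an: "a \<le> n"
    and u: "u \<in> carrier_vec a" "u \<noteq> 0\<^sub>v a" "C *\<^sub>v u = 0\<^sub>v n"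
  obtains w where "w \<in> carrier_vec n" "w \<noteq> 0\<^sub>v n" "C\<^sup>T *\<^sub>v w = 0\<^sub>v a"
proof -
  define S where "S = mat n n (\<lambda>(i, j). if j < a then C $$ (i, j) else 0)"
  define v where "v = vec n (\<lambda>i. if i < a then u $ i else 0)"
  have S: "S \<in> carrier_mat n n" by (simp add: S_def)
  obtain i where "i < a" "u $ i \<noteq> 0" using u by (auto simp: vec_eq_iff)
  then have "v $ i \<noteq> 0" "i < n" using an by (auto simp: v_def)
  then have "v \<noteq> 0\<^sub>v n" by auto
  moreover have "S *\<^sub>v v = 0\<^sub>v n"
  proof (rule eq_vecI)
    fix r assume "r < dim_vec (0\<^sub>v n :: complex vec)"
    then have r: "r < n" by simp
    have "(S *\<^sub>v v) $ r = (\<Sum>l<a + (n - a). if l < a then C $$ (r, l) * u $ l else 0)"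
      using r an by (auto simp: S_def v_def scalar_prod_def lessThan_atLeast0 intro!: sum.cong)
    also have "\<dots> = (C *\<^sub>v u) $ r"
      unfolding sum_lessThan_split using r C u(1) by (simp add: scalar_prod_def lessThan_atLeast0)
    finally show "(S *\<^sub>v v) $ r = 0\<^sub>v n $ r" using r u(3) by simp
  qed (simp add: S_def)
  ultimately have "det S = 0" using det_0_iff_vec_prod_zero[OF S] by (metis v_def vec_carrier)
  then have "det S\<^sup>T = 0" using det_transpose[OF S] by simp
  then obtain w where w: "w \<in> carrier_vec n" "w \<noteq> 0\<^sub>v n" "S\<^sup>T *\<^sub>v w = 0\<^sub>v n"
    using det_0_iff_vec_prod_zero[of "S\<^sup>T" n] S by auto
  have "C\<^sup>T *\<^sub>v w = 0\<^sub>v a"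
  proof (rule eq_vecI)
    fix j assume "j < dim_vec (0\<^sub>v a :: complex vec)"
    then have j: "j < a" by simp
    have "(C\<^sup>T *\<^sub>v w) $ j = (S\<^sup>T *\<^sub>v w) $ j"
      using j an C w(1) by (auto simp: S_def scalar_prod_def intro!: sum.cong)
    then show "(C\<^sup>T *\<^sub>v w) $ j = 0\<^sub>v a $ j" using w(3) j an by simp
  qed (use C in simp)
  then show ?thesis using w that by blast
qed

text \<open>If \<open>u \<noteq> 0\<close> is in the kernel of the lower left block and \<open>w \<noteq> 0\<close> in the kernel of its transpose, the matrix
  with upper right block \<open>u w\<^sup>T\<close> and zeros elsewhere lies in the radical.\<close>

lemma frobenius_lower_left_injective:
  assumes an: "0 < a" "a \<le> n"
    and car: "A \<in> carrier_mat a a" "B \<in> carrier_mat a n" "C \<in> carrier_mat n a" "D \<in> carrier_mat n n"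
    and fr: "frobenius_matrix a n (four_block_mat A B C D)"
    and u: "u \<in> carrier_vec a" "C *\<^sub>v u = 0\<^sub>v n"
  shows "u = 0\<^sub>v a"
proof (rule ccontr)
  assume "u \<noteq> 0\<^sub>v a"
  from singular_transpose[OF car(3) an(2) u(1) this u(2)]
  obtain w where w: "w \<in> carrier_vec n" "w \<noteq> 0\<^sub>v n" "C\<^sup>T *\<^sub>v w = 0\<^sub>v a" by blast
  define Z where "Z = mat a n (\<lambda>(i, j). u $ i * w $ j)"
  have Z: "Z \<in> carrier_mat a n" by (simp add: Z_def)
  have ZC: "Z * C = 0\<^sub>m a a"
  proof (rule eq_matI)
    fix i j assume "i < dim_row (0\<^sub>m a a :: complex mat)" "j < dim_col (0\<^sub>m a a :: complex mat)"
    then have ij: "i < a" "j < a" by auto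
    have "(Z * C) $$ (i, j) = u $ i * (\<Sum>l<n. C $$ (l, j) * w $ l)"
      unfolding mult_entry[OF Z car(3) ij] sum_distrib_left
      by (rule sum.cong) (use ij in \<open>auto simp: Z_def\<close>)
    also have "(\<Sum>l<n. C $$ (l, j) * w $ l) = (C\<^sup>T *\<^sub>v w) $ j"
      using ij car(3) w(1) by (auto simp: scalar_prod_def lessThan_atLeast0 intro!: sum.cong)
    finally show "(Z * C) $$ (i, j) = 0\<^sub>m a a $$ (i, j)" using ij w(3) by simp
  qed (use Z car in auto)
  have CZ: "C * Z = 0\<^sub>m n n"
  proof (rule eq_matI)
    fix i j assume "i < dim_row (0\<^sub>m n n :: complex mat)" "j < dim_col (0\<^sub>m n n :: complex mat)"
    then have ij: "i < n" "j < n" by auto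
    have "(C * Z) $$ (i, j) = (\<Sum>l<a. C $$ (i, l) * u $ l) * w $ j"
      unfolding mult_entry[OF car(3) Z ij] sum_distrib_right
      by (rule sum.cong) (use ij in \<open>auto simp: Z_def\<close>)
    also have "(\<Sum>l<a. C $$ (i, l) * u $ l) = (C *\<^sub>v u) $ i"
      using ij car(3) u(1) by (auto simp: scalar_prod_def lessThan_atLeast0 intro!: sum.cong)
    finally show "(C * Z) $$ (i, j) = 0\<^sub>m n n $$ (i, j)" using ij u(2) by simp
  qed (use Z car in auto)
  let ?F = "four_block_mat A B C D" and ?h = "four_block_mat (0\<^sub>m a a) Z (0\<^sub>m n a) (0\<^sub>m n n)"
  have "?F * ?h = four_block_mat (0\<^sub>m a a) (A * Z) (0\<^sub>m n a) (0\<^sub>m n n)"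
    by (subst mult_four_block_mat[of _ a a _ n _ n]) (use car Z CZ in auto)
  moreover have "?h * ?F = four_block_mat (0\<^sub>m a a) (Z * D) (0\<^sub>m n a) (0\<^sub>m n n)"
    by (subst mult_four_block_mat[of _ a a _ n _ n]) (use car Z ZC in auto)
  ultimately have "commutator ?F ?h - 0 \<cdot>\<^sub>m ?F \<in> upper_right a n"
    unfolding commutator_def upper_right_def using car Z by (auto simp del: index_mult_mat(1))
  then have "coadjoint_weight a n ?F 0 ?h"
    unfolding coadjoint_weight_def using four_block_in_block_upper[OF _ Z] by auto
  then obtain c where c: "?h = c \<cdot>\<^sub>m 1\<^sub>m (a + n)" using fr unfolding frobenius_matrix_def by blast
  obtain i j where ij: "i < a" "u $ i \<noteq> 0" "j < n" "w $ j \<noteq> 0"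
    using u(1) w(1,2) \<open>u \<noteq> 0\<^sub>v a\<close> by (auto simp: vec_eq_iff)
  have "?h $$ (i, a + j) = u $ i * w $ j" using ij Z by (simp add: Z_def)
  moreover have "?h $$ (i, a + j) = 0" unfolding c using ij by simp
  ultimately show False using ij by simp
qed

lemma frobenius_normal_form:
  assumes an: "0 < a" "a \<le> n" and F: "frobenius_matrix a n F"
  obtains g g' B F' where "g \<in> block_upper a n" "g' \<in> block_upper a n"
    "g * g' = 1\<^sub>m (a + n)" "g' * g = 1\<^sub>m (a + n)" "B \<in> carrier_mat a n" "F' \<in> carrier_mat n n"
    "g' * F * g = four_block_mat (0\<^sub>m a a) B (inclusion n a) F'"
proof -
  have Fc: "F \<in> carrier_mat (a + n) (a + n)" using F unfolding frobenius_matrix_def by simp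
  define A B C D where "A = mat a a (\<lambda>(i, j). F $$ (i, j))" and "B = mat a n (\<lambda>(i, j). F $$ (i, a + j))"
    and "C = mat n a (\<lambda>(i, j). F $$ (a + i, j))" and "D = mat n n (\<lambda>(i, j). F $$ (a + i, a + j))"
  have car: "A \<in> carrier_mat a a" "B \<in> carrier_mat a n" "C \<in> carrier_mat n a" "D \<in> carrier_mat n n"
    by (simp_all add: A_def B_def C_def D_def)
  have F_eq: "F = four_block_mat A B C D"
    using Fc by (intro eq_matI) (auto simp: A_def B_def C_def D_def)
  obtain P Q where PQ: "P \<in> carrier_mat n n" "Q \<in> carrier_mat n n" "P * Q = 1\<^sub>m n" "Q * P = 1\<^sub>m n"
    and PC: "P * C = inclusion n a"
    using injective_equivalent_inclusion[OF car(3) an(2)] frobenius_lower_left_injective[OF an car F[unfolded F_eq]]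
    by metis
  \<comment> \<open>\<open>P\<close> normalises the lower left block; the unipotent part \<open>U\<close> then clears the upper left block.\<close>
  define U where "U = mat a n (\<lambda>(i, j). if j < a then A $$ (i, j) else 0)"
  have U: "U \<in> carrier_mat a n" by (simp add: U_def)
  have UJ: "U * inclusion n a = A"
  proof (rule eq_matI)
    fix i j assume ij: "i < dim_row A" "j < dim_col A"
    then have "(U * inclusion n a) $$ (i, j) = U $$ (i, j)" using car by (intro mult_inclusion[OF U an(2)]) auto
    then show "(U * inclusion n a) $$ (i, j) = A $$ (i, j)" using ij car an by (simp add: U_def)
  qed (use U car in auto)
  have UPQ: "U * P * Q = U" using PQ U by (simp add: assoc_mult_mat[of _ a n _ n _ n])
  have UPC: "U * P * C = A" using PQ U car PC UJ by (simp add: assoc_mult_mat[of _ a n _ n _ a])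
  let ?g = "four_block_mat (1\<^sub>m a) U (0\<^sub>m n a) Q" and ?g' = "four_block_mat (1\<^sub>m a) (- (U * P)) (0\<^sub>m n a) P"
  have UP: "U * P \<in> carrier_mat a n" using U PQ by auto
  have "?g * ?g' = four_block_mat (1\<^sub>m a) (- (U * P) + U * P) (0\<^sub>m n a) (1\<^sub>m n)"
    by (subst mult_four_block_mat[of _ a a _ n _ n]) (use U UP PQ in auto)
  also have "\<dots> = 1\<^sub>m (a + n)" using UP by (simp add: uminus_l_inv_mat)
  finally have gg': "?g * ?g' = 1\<^sub>m (a + n)" .
  have "?g' * ?g = four_block_mat (1\<^sub>m a) (U + - (U * P) * Q) (0\<^sub>m n a) (1\<^sub>m n)"
    by (subst mult_four_block_mat[of _ a a _ n _ n]) (use U UP PQ in auto)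
  also have "U + - (U * P) * Q = 0\<^sub>m a n"
    using UPQ UP PQ(2) U by (subst uminus_mult_left_mat) (auto intro!: eq_matI)
  finally have g'g: "?g' * ?g = 1\<^sub>m (a + n)" by simp
  have g'F: "?g' * F = four_block_mat (A + - (U * P) * C) (B + - (U * P) * D) (P * C) (P * D)"
    unfolding F_eq by (subst mult_four_block_mat[of _ a a _ n _ n]) (use U UP PQ car in auto)
  have "- (U * P) * C = - A" using UPC UP car by (subst uminus_mult_left_mat) auto
  then have g'F: "?g' * F = four_block_mat (0\<^sub>m a a) (B + - (U * P) * D) (inclusion n a) (P * D)"
    unfolding g'F PC using car add_uminus_minus_mat[OF car(1,1)] minus_r_inv_mat[OF car(1)] by simp
  have "?g' * F * ?g = four_block_mat (0\<^sub>m a a) ((B + - (U * P) * D) * Q) (inclusion n a) (inclusion n a * U + P * D * Q)"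
    unfolding g'F by (subst mult_four_block_mat[of _ a a _ n _ n]) (use U UP PQ car in auto)
  moreover have "(B + - (U * P) * D) * Q \<in> carrier_mat a n" "inclusion n a * U + P * D * Q \<in> carrier_mat n n"
    using U UP PQ car by auto
  moreover have "?g \<in> block_upper a n" "?g' \<in> block_upper a n"
    using U UP PQ by (auto intro!: four_block_in_block_upper)
  ultimately show ?thesis using that[OF _ _ gg' g'g] by blast
qed

section \<open>Spectra of the diagonal blocks of a principal element\<close>

text \<open>The multisets of eigenvalues of the two diagonal blocks, with algebraic multiplicities.\<close>

definition has_block_spectra :: "nat \<Rightarrow> nat \<Rightarrow> complex mat \<Rightarrow> complex multiset \<Rightarrow> complex multiset \<Rightarrow> bool" where
  "has_block_spectra a b h P Q \<longleftrightarrow>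
     proots (char_poly (upper_left_block a h)) = P \<and> proots (char_poly (lower_right_block a b h)) = Q"

lemma one_smult_mat: "1 \<cdot>\<^sub>m A = (A :: complex mat)"
  by (rule eq_matI) simp_all

lemma shift_image_mset:
  "image_mset (\<lambda>x. 1 * x + 1) (image_mset (\<lambda>k. of_int k + s) P)
    = image_mset (\<lambda>k. of_int k + s) (image_mset (\<lambda>k. k + 1) P)" for s :: complex
  by (simp add: image_mset.compositionality comp_def add_ac)

lemma uminus_image_mset:
  "image_mset uminus (image_mset (\<lambda>k. of_int k + s) P)
    = image_mset (\<lambda>k. of_int k + (- s)) (image_mset uminus P)" for s :: complex
  by (simp add: image_mset.compositionality comp_def)

text \<open>Existence of Frobenius functionals with principal elements, and uniqueness of the block spectra up
  to a common shift, by induction along the Euclidean algorithm.\<close>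

theorem principal_block_spectra:
  assumes "coprime a b" "principal_pair a b = (P, Q)"
  shows "(\<exists>F h. frobenius_matrix a b F \<and> coadjoint_weight a b F 1 h) \<and>
    (\<forall>F h. frobenius_matrix a b F \<longrightarrow> coadjoint_weight a b F 1 h \<longrightarrow>
      (\<exists>s. has_block_spectra a b h (image_mset (\<lambda>k. of_int k + s) P) (image_mset (\<lambda>k. of_int k + s) Q)))"
  using assms
proof (induction a b arbitrary: P Q rule: principal_pair.induct)
  case (1 a b)
  consider "a = 0" | "0 < a" "a \<le> b" | "b < a" by linarith
  then show ?case
  proof cases
    case 1
    then have b: "b = 1" and PQ: "P = {#}" "Q = {#0#}"
      using "1.prems" by (simp_all add: principal_pair.simps)
    have "frobenius_matrix 0 1 (0\<^sub>m 1 1)"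
      unfolding frobenius_matrix_def
    proof (intro conjI allI impI)
      fix h assume "coadjoint_weight 0 1 (0\<^sub>m 1 1) 0 h"
      then have "h \<in> carrier_mat 1 1" unfolding coadjoint_weight_def by (auto dest: block_upper_carrier)
      then have "h = h $$ (0, 0) \<cdot>\<^sub>m 1\<^sub>m (0 + 1)" by (intro eq_matI) auto
      then show "\<exists>c. h = c \<cdot>\<^sub>m 1\<^sub>m (0 + 1)" by blast
    qed simp
    moreover have "coadjoint_weight 0 1 (0\<^sub>m 1 1) 1 (0\<^sub>m 1 1)"
      by (auto simp: coadjoint_weight_def block_upper_def upper_right_def commutator_def)
    moreover have "has_block_spectra 0 1 h (image_mset (\<lambda>k. of_int k + h $$ (0, 0)) P) (image_mset (\<lambda>k. of_int k + h $$ (0, 0)) Q)"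
      for h
    proof -
      have "proots (char_poly (upper_left_block 0 h)) = mset (diag_mat (upper_left_block 0 h))"
        by (rule proots_char_poly_upper_triangular[OF block_carrier(1)]) (auto simp: upper_left_block_def)
      moreover have "proots (char_poly (lower_right_block 0 1 h)) = mset (diag_mat (lower_right_block 0 1 h))"
        by (rule proots_char_poly_upper_triangular[OF block_carrier(3)]) (auto simp: lower_right_block_def)
      ultimately show ?thesis
        unfolding has_block_spectra_def PQ
        by (simp add: diag_mat_def upper_left_block_def lower_right_block_def)
    qed
    ultimately show ?thesis unfolding 1 b by blast
  next
    case 2
    define c where "c = b - a"
    have b: "b = a + c" using 2 unfolding c_def by simp
    obtain P' Q' where IH: "principal_pair a c = (P', Q')" by force
    then have PQ: "P = image_mset (\<lambda>x. x + 1) P'" "Q = P' + Q'"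
      using "1.prems" 2 unfolding c_def by (simp_all add: principal_pair.simps[of a b])
    have "coprime a c"
      using "1.prems"(1) unfolding b by (simp add: coprime_iff_gcd_eq_1)
    note IH = "1.IH"(1)[unfolded c_def[symmetric], OF _ 2(2) this IH]
    show ?thesis
    proof (intro conjI allI impI)
      obtain F Y where F: "frobenius_matrix a c F" "coadjoint_weight a c F 1 Y" using IH 2(1) by blast
      have Fc: "F \<in> carrier_mat (a + c) (a + c)" using F(1) unfolding frobenius_matrix_def by simp
      let ?N = "four_block_mat (0\<^sub>m a a) (0\<^sub>m a (a + c)) (inclusion (a + c) a) F"
      have "frobenius_matrix a b ?N"
        unfolding b using frobenius_matrix_normal_form[OF zero_carrier_mat Fc] F(1) by blast
      moreover obtain h where "coadjoint_weight a b ?N 1 h"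
        unfolding b using normal_form_extend[OF zero_carrier_mat Fc F(2)] by blast
      ultimately show "\<exists>F h. frobenius_matrix a b F \<and> coadjoint_weight a b F 1 h" by blast
    next
      fix F h assume F: "frobenius_matrix a b F" and w: "coadjoint_weight a b F 1 h"
      have Fc: "F \<in> carrier_mat (a + b) (a + b)" using F unfolding frobenius_matrix_def by simp
      have hb: "h \<in> block_upper a b" using w unfolding coadjoint_weight_def by blast
      obtain g g' B F' where g: "g \<in> block_upper a b" "g' \<in> block_upper a b"
        "g * g' = 1\<^sub>m (a + b)" "g' * g = 1\<^sub>m (a + b)" and B: "B \<in> carrier_mat a b" and F': "F' \<in> carrier_mat b b"
        and N: "g' * F * g = four_block_mat (0\<^sub>m a a) B (inclusion b a) F'"
        using frobenius_normal_form[OF 2 F] by metis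
      define h1 where "h1 = g' * h * g"
      define X Z Y where "X = upper_left_block a h1" and "Z = upper_right_block a b h1"
        and "Y = lower_right_block a b h1"
      have "frobenius_matrix a b (four_block_mat (0\<^sub>m a a) B (inclusion b a) F')"
        unfolding N[symmetric] by (rule frobenius_matrix_conjugate[OF F g])
      then have fr: "frobenius_matrix a c F'"
        using frobenius_matrix_normal_form[OF B[unfolded b] F'[unfolded b]] unfolding b by blast
      have w1: "coadjoint_weight a b (four_block_mat (0\<^sub>m a a) B (inclusion b a) F') 1 h1"
        unfolding N[symmetric] h1_def by (rule coadjoint_weight_conjugate[OF Fc g(1-3) w])
      have h1: "h1 = four_block_mat X Z (0\<^sub>m b a) Y"
        unfolding X_def Y_def Z_def using w1 unfolding coadjoint_weight_def
        by (intro block_upper_eq_four_block) blast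
      have car: "X \<in> carrier_mat a a" "Z \<in> carrier_mat a b" "Y \<in> carrier_mat b b"
        unfolding X_def Y_def Z_def by auto
      note red = normal_form_reduce[OF B[unfolded b] F'[unfolded b] car[unfolded b] w1[unfolded h1, unfolded b]]
      obtain s where s: "proots (char_poly (upper_left_block a Y)) = image_mset (\<lambda>k. of_int k + s) P'"
        "proots (char_poly (lower_right_block a c Y)) = image_mset (\<lambda>k. of_int k + s) Q'"
        using IH 2(1) fr red(1) unfolding has_block_spectra_def by blast
      have "proots (char_poly X) = image_mset (\<lambda>k. of_int k + s) P"
        using proots_char_poly_affine[OF block_carrier(1)[of a Y], of 1 1]
        unfolding s(1) red(2) PQ one_smult_mat shift_image_mset .
      moreover have "proots (char_poly Y) = image_mset (\<lambda>k. of_int k + s) Q"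
        using proots_char_poly_block_upper[of Y a c] red(1) s unfolding PQ coadjoint_weight_def by simp
      moreover have "char_poly X = char_poly (upper_left_block a h)" "char_poly Y = char_poly (lower_right_block a b h)"
        unfolding X_def Y_def h1_def by (rule block_char_poly_conjugate[OF hb g])+
      ultimately show "\<exists>s. has_block_spectra a b h (image_mset (\<lambda>k. of_int k + s) P) (image_mset (\<lambda>k. of_int k + s) Q)"
        unfolding has_block_spectra_def by auto
    qed
  next
    case 3
    obtain P' Q' where IH: "principal_pair b a = (P', Q')" by force
    then have PQ: "P = image_mset uminus Q'" "Q = image_mset uminus P'"
      using "1.prems" 3 by (simp_all add: principal_pair.simps[of a b])
    note IH = "1.IH"(2)[OF _ _ _ IH]
    have cop: "coprime b a" using "1.prems"(1) by (simp add: coprime_commute)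
    have IH1: "\<exists>F h. frobenius_matrix b a F \<and> coadjoint_weight b a F 1 h"
      and IH2: "\<And>F h. frobenius_matrix b a F \<Longrightarrow> coadjoint_weight b a F 1 h \<Longrightarrow>
      \<exists>s. has_block_spectra b a h (image_mset (\<lambda>k. of_int k + s) P') (image_mset (\<lambda>k. of_int k + s) Q')"
      using IH 3 cop by auto
    show ?thesis
    proof (intro conjI allI impI)
      obtain F h where F: "frobenius_matrix b a F" "coadjoint_weight b a F 1 h" using IH1 by blast
      then have "F \<in> carrier_mat (b + a) (b + a)" unfolding frobenius_matrix_def by simp
      then show "\<exists>F h. frobenius_matrix a b F \<and> coadjoint_weight a b F 1 h"
        using frobenius_matrix_flip[OF F(1)] coadjoint_weight_flip[OF _ F(2)] by blast
    next
      fix F h assume F: "frobenius_matrix a b F" and w: "coadjoint_weight a b F 1 h"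
      have Fc: "F \<in> carrier_mat (a + b) (a + b)" using F unfolding frobenius_matrix_def by simp
      obtain s where s: "has_block_spectra b a (flip a b h) (image_mset (\<lambda>k. of_int k + s) P') (image_mset (\<lambda>k. of_int k + s) Q')"
        using IH2[OF frobenius_matrix_flip[OF F] coadjoint_weight_flip[OF Fc w]] by blast
      have "image_mset uminus (proots (char_poly (lower_right_block a b h))) = image_mset (\<lambda>k. of_int k + s) P'"
        "image_mset uminus (proots (char_poly (upper_left_block a h))) = image_mset (\<lambda>k. of_int k + s) Q'"
        using s unfolding has_block_spectra_def flip_blocks
        by (simp_all add: proots_char_poly_neg_transpose[OF block_carrier(1)] proots_char_poly_neg_transpose[OF block_carrier(3)])
      then have "image_mset uminus (image_mset uminus (proots (char_poly (lower_right_block a b h)))) = image_mset (\<lambda>k. of_int k + (- s)) Q"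
        "image_mset uminus (image_mset uminus (proots (char_poly (upper_left_block a h)))) = image_mset (\<lambda>k. of_int k + (- s)) P"
        unfolding PQ by (simp_all only: uminus_image_mset)
      then show "\<exists>s. has_block_spectra a b h (image_mset (\<lambda>k. of_int k + s) P) (image_mset (\<lambda>k. of_int k + s) Q)"
        unfolding has_block_spectra_def by (intro exI[of _ "- s"]) (simp add: image_mset.compositionality comp_def)
    qed
  qed
qed

section \<open>The characteristic polynomial of an endomorphism\<close>

text \<open>\<open>T\<close> restricts to a linear endomorphism of \<open>V\<close>.\<close>

abbreviation linear_endo :: "(complex, 'v) module \<Rightarrow> ('v \<Rightarrow> 'v) \<Rightarrow> bool" where
  "linear_endo V T \<equiv> T \<in> carrier V \<rightarrow> carrier V \<and>
     (\<forall>x\<in>carrier V. \<forall>y\<in>carrier V. T (x \<oplus>\<^bsub>V\<^esub> y) = T x \<oplus>\<^bsub>V\<^esub> T y) \<and>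
     (\<forall>c. \<forall>x\<in>carrier V. T (c \<odot>\<^bsub>V\<^esub> x) = c \<odot>\<^bsub>V\<^esub> T x)"

context
  fixes V :: "(complex, 'v) module"
  assumes vs: "vectorspace class_ring V"
begin

interpretation vectorspace class_ring V by (fact vs)

text \<open>The linear combination of the list \<open>bs\<close> with coefficients \<open>c\<close>; only \<open>c i\<close> with \<open>i < length bs\<close> matters.\<close>

definition comb :: "'v list \<Rightarrow> (nat \<Rightarrow> complex) \<Rightarrow> 'v" where
  "comb bs c = (\<Oplus>\<^bsub>V\<^esub>i\<in>{..<length bs}. c i \<odot>\<^bsub>V\<^esub> bs ! i)"

lemma comb_closed: "set bs \<subseteq> carrier V \<Longrightarrow> comb bs c \<in> carrier V"
  unfolding comb_def by (rule finsum_closed) (auto simp: class_ring_simps dest: nth_mem)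

lemma comb_cong: "set bs \<subseteq> carrier V \<Longrightarrow> (\<And>i. i < length bs \<Longrightarrow> c i = d i) \<Longrightarrow> comb bs c = comb bs d"
  unfolding comb_def by (rule finsum_cong2) (auto simp: class_ring_simps dest: nth_mem)

lemma comb_add: "set bs \<subseteq> carrier V \<Longrightarrow> comb bs (\<lambda>i. c i + d i) = comb bs c \<oplus>\<^bsub>V\<^esub> comb bs d"
  unfolding comb_def
  by (subst finsum_addf[symmetric])
    (auto simp: class_ring_simps smult_l_distr[simplified] dest: nth_mem intro!: finsum_cong2)

lemma comb_smult: "set bs \<subseteq> carrier V \<Longrightarrow> comb bs (\<lambda>i. k * c i) = k \<odot>\<^bsub>V\<^esub> comb bs c"
  unfolding comb_def
  by (subst finsum_smult)
    (auto simp: class_ring_simps smult_assoc1[simplified] dest: nth_mem intro!: finsum_cong2)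

lemma comb_unit:
  assumes "set bs \<subseteq> carrier V" "j < length bs"
  shows "comb bs (\<lambda>i. if i = j then 1 else 0) = bs ! j"
proof -
  have "comb bs (\<lambda>i. if i = j then 1 else 0)
      = (\<Oplus>\<^bsub>V\<^esub>i\<in>{..<length bs}. if j = i then bs ! i else \<zero>\<^bsub>V\<^esub>)"
    unfolding comb_def using assms(1)
    by (intro finsum_cong2) (auto simp: smult_one[simplified] lmult_0[simplified] subset_iff)
  also have "\<dots> = bs ! j" using assms by (intro finsum_singleton) (auto simp: subset_iff)
  finally show ?thesis .
qed

lemma comb_lincomb:
  assumes "distinct bs" "set bs \<subseteq> carrier V"
  shows "lincomb c (set bs) = comb bs (\<lambda>i. c (bs ! i))"
proof -
  have "set bs = (!) bs ` {..<length bs}" by (auto simp: in_set_conv_nth)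
  moreover have "inj_on ((!) bs) {..<length bs}" using assms(1) by (auto simp: inj_on_def nth_eq_iff_index_eq)
  ultimately show ?thesis unfolding lincomb_def comb_def
    using assms(2) by (simp add: add.finprod_reindex Pi_def subset_iff)
qed

lemma ordered_basis_carrier: "ordered_basis V bs \<Longrightarrow> set bs \<subseteq> carrier V"
  unfolding ordered_basis_def basis_def by simp

lemma ordered_basis_span:
  assumes "ordered_basis V bs" "x \<in> carrier V"
  shows "\<exists>c. x = comb bs c"
proof -
  have "x \<in> span (set bs)" "set bs \<subseteq> carrier V" using assms unfolding ordered_basis_def basis_def by auto
  then obtain c where "x = lincomb c (set bs)" by (auto simp: finite_span)
  then show ?thesis using assms comb_lincomb[of bs c] unfolding ordered_basis_def basis_def by auto
qed

lemma ordered_basis_indep: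
  assumes bs: "ordered_basis V bs" and eq: "comb bs c = \<zero>\<^bsub>V\<^esub>" and i: "i < length bs"
  shows "c i = 0"
proof (rule ccontr)
  assume c: "c i \<noteq> 0"
  have car: "set bs \<subseteq> carrier V" and dist: "distinct bs" and li: "lin_indpt (set bs)"
    using bs unfolding ordered_basis_def basis_def by auto
  define d where "d = (\<lambda>v. c (THE j. j < length bs \<and> bs ! j = v))"
  have d: "d (bs ! j) = c j" if "j < length bs" for j
    unfolding d_def
    by (rule arg_cong[of _ _ c], rule the_equality) (use that dist nth_eq_iff_index_eq in auto)
  have "lincomb d (set bs) = comb bs c"
    using comb_cong[OF car, of "\<lambda>i. d (bs ! i)" c] d by (simp add: comb_lincomb[OF dist car])
  then have "lin_dep (set bs)"
    unfolding lin_dep_def using eq c d[OF i] i by (intro exI[of _ "set bs"] exI[of _ d] exI[of _ "bs ! i"]) auto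
  then show False using li by simp
qed

lemma ordered_basisI:
  assumes car: "set bs \<subseteq> carrier V"
    and span: "\<And>x. x \<in> carrier V \<Longrightarrow> \<exists>c. x = comb bs c"
    and indep: "\<And>c i. comb bs c = \<zero>\<^bsub>V\<^esub> \<Longrightarrow> i < length bs \<Longrightarrow> c i = 0"
  shows "ordered_basis V bs"
proof -
  have dist: "distinct bs"
  proof (rule ccontr)
    assume "\<not> distinct bs"
    then obtain i j where ij: "i < length bs" "j < length bs" "i \<noteq> j" "bs ! i = bs ! j"
      by (auto simp: distinct_conv_nth)
    define e where "e = (\<lambda>k l :: nat. if l = k then 1 else 0 :: complex)"
    have e: "comb bs (e k) = bs ! k" if "k < length bs" for k
      using comb_unit[OF car that] unfolding e_def .
    have "comb bs (\<lambda>l. e i l + (- 1) * e j l) = bs ! i \<oplus>\<^bsub>V\<^esub> (- 1) \<odot>\<^bsub>V\<^esub> (bs ! i)"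
      using ij e car by (simp only: comb_add comb_smult)
    also have "\<dots> = (1 + (-1)) \<odot>\<^bsub>V\<^esub> (bs ! i)"
      using ij car smult_l_distr[of 1 "-1" "bs ! i"] smult_one[of "bs ! i"] by (auto simp: subset_iff)
    also have "\<dots> = \<zero>\<^bsub>V\<^esub>" using ij car lmult_0[of "bs ! i"] by (auto simp: subset_iff)
    finally have "e i i + (- 1) * e j i = 0" by (rule indep) (rule ij)
    then show False using ij by (simp add: e_def)
  qed
  have "lin_indpt (set bs)"
  proof
    assume "lin_dep (set bs)"
    then obtain c v where "c \<in> set bs \<rightarrow> UNIV" "lincomb c (set bs) = \<zero>\<^bsub>V\<^esub>" "v \<in> set bs" "c v \<noteq> 0"
      using finite_lin_dep[of "set bs"] car by auto
    then show False
      using indep[of "\<lambda>i. c (bs ! i)"] by (auto simp: comb_lincomb[OF dist car] in_set_conv_nth)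
  qed
  moreover have "gen_set (set bs)"
  proof
    show "span (set bs) \<subseteq> carrier V" by (rule span_is_subset2[OF car])
    show "carrier V \<subseteq> span (set bs)"
    proof
      fix x assume "x \<in> carrier V"
      then obtain c where c: "x = comb bs c" using span by blast
      define d where "d = (\<lambda>v. c (THE j. j < length bs \<and> bs ! j = v))"
      have d: "d (bs ! j) = c j" if "j < length bs" for j
        unfolding d_def
        by (rule arg_cong[of _ _ c], rule the_equality) (use that dist nth_eq_iff_index_eq in auto)
      have "x = lincomb d (set bs)" unfolding c comb_lincomb[OF dist car]
        by (rule comb_cong[OF car]) (simp add: d)
      then show "x \<in> span (set bs)" using car by (auto simp: finite_span)
    qed
  qed
  ultimately show ?thesis using dist car unfolding ordered_basis_def basis_def by simp
qed

text \<open>The coordinate functionals of an ordered basis.\<close>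

lemma ordered_basis_coordinates:
  assumes bs: "ordered_basis V bs"
  obtains co where "\<And>k. linear_functional V (co k)"
    "\<And>x. x \<in> carrier V \<Longrightarrow> x = comb bs (\<lambda>i. co i x)"
    "\<And>c k. k < length bs \<Longrightarrow> co k (comb bs c) = c k"
proof -
  note car = ordered_basis_carrier[OF bs]
  have unique: "c k = d k" if "comb bs c = comb bs d" "k < length bs" for c d k
  proof -
    have "comb bs (\<lambda>i. c i + (- 1) * d i) = comb bs c \<oplus>\<^bsub>V\<^esub> (- 1) \<odot>\<^bsub>V\<^esub> comb bs c"
      using car that(1) by (simp only: comb_add comb_smult)
    also have "\<dots> = (1 + (-1)) \<odot>\<^bsub>V\<^esub> comb bs c"
      using comb_closed[OF car] smult_l_distr[of 1 "-1" "comb bs c"] smult_one[of "comb bs c"] by simp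
    also have "\<dots> = \<zero>\<^bsub>V\<^esub>" using comb_closed[OF car] lmult_0[of "comb bs c"] by simp
    finally show ?thesis using ordered_basis_indep[OF bs _ that(2)] by force
  qed
  define co where "co = (\<lambda>k x. if k < length bs then (SOME c. x = comb bs c) k else 0)"
  have co: "x = comb bs (\<lambda>i. co i x)" if "x \<in> carrier V" for x
  proof -
    have "x = comb bs (SOME c. x = comb bs c)"
      using ordered_basis_span[OF bs that] by (rule someI_ex)
    also have "\<dots> = comb bs (\<lambda>i. co i x)" by (rule comb_cong[OF car]) (simp add: co_def)
    finally show ?thesis .
  qed
  have co_comb: "co k (comb bs c) = c k" if "k < length bs" for c k
    by (rule unique[OF co[symmetric] that]) (rule comb_closed[OF car])
  have "linear_functional V (co k)" for k
  proof (cases "k < length bs")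
    case True
    show ?thesis unfolding linear_functional_def
    proof (intro conjI ballI allI)
      fix x y assume "x \<in> carrier V" "y \<in> carrier V"
      then have "x \<oplus>\<^bsub>V\<^esub> y = comb bs (\<lambda>i. co i x + co i y)" using co comb_add[OF car] by metis
      then show "co k (x \<oplus>\<^bsub>V\<^esub> y) = co k x + co k y" using co_comb[OF True] by metis
    next
      fix c x assume "x \<in> carrier V"
      then have "c \<odot>\<^bsub>V\<^esub> x = comb bs (\<lambda>i. c * co i x)" using co comb_smult[OF car] by metis
      then show "co k (c \<odot>\<^bsub>V\<^esub> x) = c * co k x" using co_comb[OF True] by metis
    qed
  qed (simp add: linear_functional_def co_def)
  then show ?thesis using co co_comb that by blast
qed

lemma linear_functional_zero: "linear_functional V f \<Longrightarrow> f \<zero>\<^bsub>V\<^esub> = 0"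
proof -
  assume f: "linear_functional V f"
  have "f (0 \<odot>\<^bsub>V\<^esub> \<zero>\<^bsub>V\<^esub>) = 0 * f \<zero>\<^bsub>V\<^esub>"
    using f zero_closed unfolding linear_functional_def by blast
  then show ?thesis using lmult_0[of "\<zero>\<^bsub>V\<^esub>"] by simp
qed

lemma linear_functional_finsum:
  assumes f: "linear_functional V f" and "finite A" "g \<in> A \<rightarrow> carrier V"
  shows "f (finsum V g A) = (\<Sum>x\<in>A. f (g x))"
  using assms(2,3)
proof (induction A rule: finite_induct)
  case empty
  then show ?case using linear_functional_zero[OF f] by simp
next
  case (insert x A)
  then show ?case using f finsum_closed[of g A] unfolding linear_functional_def by auto
qed

lemma linear_functional_comb:
  assumes "linear_functional V f" "set bs \<subseteq> carrier V"
  shows "f (comb bs c) = (\<Sum>i<length bs. c i * f (bs ! i))"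
proof -
  have "f (comb bs c) = (\<Sum>i<length bs. f (c i \<odot>\<^bsub>V\<^esub> bs ! i))"
    unfolding comb_def using assms by (intro linear_functional_finsum) (auto simp: subset_iff)
  also have "\<dots> = (\<Sum>i<length bs. c i * f (bs ! i))"
    using assms unfolding linear_functional_def by (intro sum.cong) (auto simp: subset_iff)
  finally show ?thesis .
qed

lemma linear_functional_endo:
  "linear_functional V f \<Longrightarrow> linear_endo V T \<Longrightarrow> linear_functional V (\<lambda>x. f (T x))"
  unfolding linear_functional_def by (simp add: Pi_iff)

lemma represents_comb:
  "represents V T bs M \<longleftrightarrow> M \<in> carrier_mat (length bs) (length bs) \<and>
     (\<forall>j<length bs. T (bs ! j) = comb bs (\<lambda>i. M $$ (i, j)))"
  unfolding represents_def comb_def by simp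

lemma ordered_basis_length_unique:
  assumes bs: "ordered_basis V bs" "ordered_basis V bs'"
  shows "length bs = length bs'"
  using bs dim_basis[of "set bs"] dim_basis[of "set bs'"]
  unfolding ordered_basis_def by (simp add: distinct_card)

text \<open>The matrices of an endomorphism in two bases are conjugate by the matrices of base change.\<close>

lemma represents_similar:
  assumes T: "linear_endo V T"
    and bs: "ordered_basis V bs" "represents V T bs M"
    and bs': "ordered_basis V bs'" "represents V T bs' M'"
  shows "similar_mat M M'"
proof -
  define n where "n = length bs"
  have n: "length bs = n" "length bs' = n" using ordered_basis_length_unique[OF bs(1) bs'(1)] n_def by auto
  note car = ordered_basis_carrier[OF bs(1)] ordered_basis_carrier[OF bs'(1)]
  obtain co where co: "\<And>k. linear_functional V (co k)"
    "\<And>x. x \<in> carrier V \<Longrightarrow> x = comb bs (\<lambda>i. co i x)"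
    "\<And>c k. k < n \<Longrightarrow> co k (comb bs c) = c k"
    using ordered_basis_coordinates[OF bs(1)] unfolding n by metis
  obtain co' where co': "\<And>k. linear_functional V (co' k)"
    "\<And>x. x \<in> carrier V \<Longrightarrow> x = comb bs' (\<lambda>i. co' i x)"
    "\<And>c k. k < n \<Longrightarrow> co' k (comb bs' c) = c k"
    using ordered_basis_coordinates[OF bs'(1)] unfolding n by metis
  define P where "P = mat n n (\<lambda>(i, j). co i (bs' ! j))"
  define Q where "Q = mat n n (\<lambda>(i, j). co' i (bs ! j))"
  have mem: "bs ! i \<in> carrier V" "bs' ! i \<in> carrier V" if "i < n" for i
    using car n that by (auto simp: subset_iff)
  have M: "M \<in> carrier_mat n n" "\<And>j. j < n \<Longrightarrow> T (bs ! j) = comb bs (\<lambda>i. M $$ (i, j))"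
    using bs(2) unfolding represents_comb n by auto
  have M': "M' \<in> carrier_mat n n" "\<And>j. j < n \<Longrightarrow> T (bs' ! j) = comb bs' (\<lambda>i. M' $$ (i, j))"
    using bs'(2) unfolding represents_comb n by auto
  have unit: "(\<Sum>i<n. co k (bs' ! i) * co' i x) = co k x" if "x \<in> carrier V" for k x
    using linear_functional_comb[OF co(1) car(2), of k "\<lambda>i. co' i x"] co'(2)[OF that, symmetric] n by (simp add: mult.commute)
  have unit': "(\<Sum>i<n. co' k (bs ! i) * co i x) = co' k x" if "x \<in> carrier V" for k x
    using linear_functional_comb[OF co'(1) car(1), of k "\<lambda>i. co i x"] co(2)[OF that, symmetric] n by (simp add: mult.commute)
  have delta: "co k (bs ! j) = (if k = j then 1 else 0)" "co' k (bs' ! j) = (if k = j then 1 else 0)"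
    if "k < n" "j < n" for k j
    using that co(3)[of k "\<lambda>i. if i = j then 1 else 0"] comb_unit[OF car(1), of j]
      co'(3)[of k "\<lambda>i. if i = j then 1 else 0"] comb_unit[OF car(2), of j] n by simp_all
  have PQ: "P * Q = 1\<^sub>m n"
    by (rule eq_matI)
      (use unit mem delta in \<open>auto simp: P_def Q_def scalar_prod_def lessThan_atLeast0\<close>)
  have QP: "Q * P = 1\<^sub>m n"
    by (rule eq_matI)
      (use unit' mem delta in \<open>auto simp: P_def Q_def scalar_prod_def lessThan_atLeast0\<close>)
  have MP: "M * P = P * M'"
  proof (rule eq_matI)
    fix k j assume kj: "k < dim_row (P * M')" "j < dim_col (P * M')"
    then have kj: "k < n" "j < n" using M' by (simp_all add: P_def)
    have "(M * P) $$ (k, j) = (\<Sum>i<n. co i (bs' ! j) * co k (T (bs ! i)))"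
      using kj M co(3)[OF kj(1)] by (simp add: P_def scalar_prod_def lessThan_atLeast0 mult.commute)
    also have "\<dots> = co k (T (bs' ! j))"
      using linear_functional_comb[OF linear_functional_endo[OF co(1) T] car(1), of k "\<lambda>i. co i (bs' ! j)"]
        co(2)[OF mem(2)[OF kj(2)], symmetric] n by simp
    also have "\<dots> = (\<Sum>i<n. M' $$ (i, j) * co k (bs' ! i))"
      using linear_functional_comb[OF co(1) car(2), of k] M'(2)[OF kj(2)] n by simp
    also have "\<dots> = (P * M') $$ (k, j)"
      using kj M' by (simp add: P_def scalar_prod_def lessThan_atLeast0 mult.commute)
    finally show "(M * P) $$ (k, j) = (P * M') $$ (k, j)" .
  qed (use M M' in \<open>simp_all add: P_def\<close>)
  have PQc: "P \<in> carrier_mat n n" "Q \<in> carrier_mat n n" by (simp_all add: P_def Q_def)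
  have "M = P * M' * Q"
  proof -
    have "P * M' * Q = M * P * Q" using MP by simp
    also have "\<dots> = M * (P * Q)" using M PQc by (simp add: assoc_mult_mat[of _ n n _ n _ n])
    finally show ?thesis using PQ M by simp
  qed
  then show ?thesis
    using PQ QP PQc M M' by (intro similar_matI[of _ _ P Q n]) auto
qed

lemma operator_char_poly_eq:
  assumes "linear_endo V T" "ordered_basis V bs" "represents V T bs M"
  shows "operator_char_poly V T = char_poly M"
  unfolding operator_char_poly_def
proof (rule the_equality)
  show "\<exists>bs M'. ordered_basis V bs \<and> represents V T bs M' \<and> char_poly M = char_poly M'"
    using assms by blast
next
  fix p assume "\<exists>bs M. ordered_basis V bs \<and> represents V T bs M \<and> p = char_poly M"
  then show "p = char_poly M" using represents_similar assms char_poly_similar by metis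
qed

end

section \<open>The parabolic algebra as a vector space\<close>

lemma mat_trace_sum: "x \<in> carrier_mat n n \<Longrightarrow> mat_trace x = (\<Sum>i<n. x $$ (i, i))"
  unfolding mat_trace_def diag_mat_def
  by (simp add: interv_sum_list_conv_sum_set_nat lessThan_atLeast0)

lemma mat_trace_mult:
  assumes "x \<in> carrier_mat n n" "y \<in> carrier_mat n n"
  shows "mat_trace (x * y) = (\<Sum>i<n. \<Sum>j<n. x $$ (i, j) * y $$ (j, i))"
proof -
  have "mat_trace (x * y) = (\<Sum>i<n. (x * y) $$ (i, i))" using assms by (intro mat_trace_sum) auto
  then show ?thesis using mult_entry[OF assms] by simp
qed

lemma mat_trace_mult_commute:
  assumes "x \<in> carrier_mat n n" "y \<in> carrier_mat n n"
  shows "mat_trace (x * y) = mat_trace (y * x)"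
  unfolding mat_trace_mult[OF assms] mat_trace_mult[OF assms(2,1)]
  by (subst sum.swap) (simp add: mult.commute)

lemma mat_trace_add:
  "x \<in> carrier_mat n n \<Longrightarrow> y \<in> carrier_mat n n \<Longrightarrow> mat_trace (x + y) = mat_trace x + mat_trace y"
  by (simp add: mat_trace_sum[of _ n] sum.distrib)

lemma mat_trace_diff:
  "x \<in> carrier_mat n n \<Longrightarrow> y \<in> carrier_mat n n \<Longrightarrow> mat_trace (x - y) = mat_trace x - mat_trace y"
  using mat_trace_sum[of "x - y" n] by (simp add: mat_trace_sum[of _ n] sum_subtractf minus_carrier_mat)

lemma mat_trace_smult: "x \<in> carrier_mat n n \<Longrightarrow> mat_trace (c \<cdot>\<^sub>m x) = c * mat_trace x"
  by (simp add: mat_trace_sum[of _ n] sum_distrib_left)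

lemma mat_trace_one: "mat_trace (1\<^sub>m n) = of_nat n"
  by (simp add: mat_trace_sum[of _ n])

lemma mat_trace_commutator:
  assumes "x \<in> carrier_mat n n" "y \<in> carrier_mat n n"
  shows "mat_trace (commutator x y) = 0"
  unfolding commutator_def using assms mat_trace_mult_commute[OF assms]
  by (subst mat_trace_diff[of _ n]) auto

lemma parabolic_simps:
  "\<zero>\<^bsub>parabolic a b\<^esub> = 0\<^sub>m (a + b) (a + b)"
  "x \<oplus>\<^bsub>parabolic a b\<^esub> y = x + y"
  "c \<odot>\<^bsub>parabolic a b\<^esub> x = c \<cdot>\<^sub>m x"
  by (simp_all add: parabolic_def module_mat_def)

lemma parabolic_carrier: "carrier (parabolic a b) = {x \<in> block_upper a b. mat_trace x = 0}"
proof -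
  have trace: "mat_trace (four_block_mat X Z C Y) = mat_trace X + mat_trace Y"
    if "X \<in> carrier_mat a a" "Y \<in> carrier_mat b b" for X Y Z C
    unfolding mat_trace_def diag_four_block_mat[OF that] by simp
  show ?thesis
  proof (intro equalityI subsetI)
    fix x assume "x \<in> carrier (parabolic a b)"
    then show "x \<in> {x \<in> block_upper a b. mat_trace x = 0}"
      by (auto simp: parabolic_def trace intro!: four_block_in_block_upper)
  next
    fix x assume x: "x \<in> {x \<in> block_upper a b. mat_trace x = 0}"
    then have eq: "x = four_block_mat (upper_left_block a x) (upper_right_block a b x) (0\<^sub>m b a) (lower_right_block a b x)"
      by (intro block_upper_eq_four_block) simp
    have "mat_trace (upper_left_block a x) + mat_trace (lower_right_block a b x) = 0"
      using x trace[OF block_carrier(1)[of a x] block_carrier(3)[of a b x], of "upper_right_block a b x" "0\<^sub>m b a"]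
        eq[symmetric] by simp
    then show "x \<in> carrier (parabolic a b)"
      using eq unfolding parabolic_def by simp (metis block_carrier)
  qed
qed

lemma block_upper_linear:
  "x \<in> block_upper a b \<Longrightarrow> y \<in> block_upper a b \<Longrightarrow> x + y \<in> block_upper a b"
  "x \<in> block_upper a b \<Longrightarrow> y \<in> block_upper a b \<Longrightarrow> x - y \<in> block_upper a b"
  "x \<in> block_upper a b \<Longrightarrow> c \<cdot>\<^sub>m x \<in> block_upper a b"
  "0\<^sub>m (a + b) (a + b) \<in> block_upper a b"
  "1\<^sub>m (a + b) \<in> block_upper a b"
  by (auto simp: block_upper_def)

lemma parabolic_mem:
  assumes "x \<in> carrier (parabolic a b)"
  shows "x \<in> block_upper a b" "x \<in> carrier_mat (a + b) (a + b)" "mat_trace x = 0"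
  using assms block_upper_carrier by (auto simp: parabolic_carrier)

lemma vectorspace_parabolic: "vectorspace class_ring (parabolic a b)"
proof -
  let ?V = "parabolic a b"
  note C = parabolic_mem(2)
  have closed: "x + y \<in> carrier ?V" "c \<cdot>\<^sub>m x \<in> carrier ?V"
    if "x \<in> carrier ?V" "y \<in> carrier ?V" for x y c
    using that C[OF that(1)] C[OF that(2)]
    by (auto simp: parabolic_carrier block_upper_linear mat_trace_add[of _ "a + b"] mat_trace_smult[of _ "a + b"])
  have zero: "0\<^sub>m (a + b) (a + b) \<in> carrier ?V"
    by (simp add: parabolic_carrier block_upper_linear mat_trace_sum[of _ "a + b"])
  have group: "abelian_group ?V"
  proof (rule abelian_groupI; unfold parabolic_simps)
    fix x y z assume xyz: "x \<in> carrier ?V" "y \<in> carrier ?V" "z \<in> carrier ?V"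
    note C[OF xyz(1)] C[OF xyz(2)] C[OF xyz(3)]
    then show "x + y + z = x + (y + z)" by (rule assoc_add_mat)
  next
    fix x y assume xy: "x \<in> carrier ?V" "y \<in> carrier ?V"
    show "x + y = y + x" using C[OF xy(1)] C[OF xy(2)] by (rule comm_add_mat)
    show "x + y \<in> carrier ?V" using closed xy by blast
  next
    fix x assume x: "x \<in> carrier ?V"
    show "0\<^sub>m (a + b) (a + b) + x = x" using C[OF x] by simp
    have "(-1) \<cdot>\<^sub>m x + x = 0\<^sub>m (a + b) (a + b)" using C[OF x] by (intro eq_matI) auto
    then show "\<exists>y\<in>carrier ?V. y + x = 0\<^sub>m (a + b) (a + b)" using closed(2)[OF x x] by blast
  qed (rule zero)
  have "cring (class_ring :: complex ring)" by (rule class_cring.cring_axioms)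
  then have "Module.module class_ring ?V"
  proof (rule Module.moduleI[OF _ group]; unfold parabolic_simps class_ring_simps)
    fix c d x y assume xy: "x \<in> carrier ?V" "y \<in> carrier ?V"
    show "c \<cdot>\<^sub>m x \<in> carrier ?V" using closed xy by blast
    show "c \<cdot>\<^sub>m (x + y) = c \<cdot>\<^sub>m x + c \<cdot>\<^sub>m y" by (rule add_smult_distrib_left_mat[OF C[OF xy(1)] C[OF xy(2)]])
    show "(c + d) \<cdot>\<^sub>m x = c \<cdot>\<^sub>m x + d \<cdot>\<^sub>m x" by (rule add_smult_distrib_right_mat[OF C[OF xy(1)]])
    show "(c * d) \<cdot>\<^sub>m x = c \<cdot>\<^sub>m (d \<cdot>\<^sub>m x)" using C[OF xy(1)] by (intro eq_matI) auto
    show "1 \<cdot>\<^sub>m x = x" by (rule one_smult_mat)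
  qed
  moreover have "field (class_ring :: complex ring)" by (rule class_field.field_axioms)
  ultimately show ?thesis unfolding vectorspace_def by simp
qed

section \<open>The characteristic polynomial of the adjoint action\<close>

text \<open>The matrix unit at position \<open>p\<close>, made traceless by subtracting the last diagonal unit if \<open>p\<close> lies on the
  diagonal.  For \<open>p = (n - 1, n - 1)\<close> it is zero.\<close>

definition trace_free_unit :: "nat \<Rightarrow> nat \<times> nat \<Rightarrow> complex mat" where
  "trace_free_unit n p = mat n n (\<lambda>q. (if q = p then 1 else 0) - (if fst p = snd p \<and> q = (n - 1, n - 1) then 1 else 0))"

text \<open>The positions inside the upper left, the lower right and the upper right block.\<close>

definition all_positions :: "nat \<Rightarrow> nat \<Rightarrow> (nat \<times> nat) list" where
  "all_positions a b = List.product [0..<a] [0..<a] @ List.product [a..<a + b] [a..<a + b] @ List.product [0..<a] [a..<a + b]"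

text \<open>The positions that index the basis of traceless units: all but the last diagonal one, sorted by \<open>i - j\<close>.  In
  this order the adjoint action of an upper triangular matrix is upper triangular.\<close>

definition positions :: "nat \<Rightarrow> nat \<Rightarrow> (nat \<times> nat) list" where
  "positions a b = sort_key (\<lambda>(i, j). int i - int j) (remove1 (a + b - 1, a + b - 1) (all_positions a b))"

lemma set_all_positions:
  "set (all_positions a b) = {(i, j). i < a + b \<and> j < a + b \<and> \<not> (a \<le> i \<and> j < a)}"
  by (auto simp: all_positions_def)

lemma distinct_all_positions: "distinct (all_positions a b)"
  unfolding all_positions_def by (auto simp: distinct_product)

lemma mset_positions:
  assumes "0 < a + b"
  shows "add_mset (a + b - 1, a + b - 1) (mset (positions a b)) = mset (all_positions a b)"
proof -
  have "(a + b - 1, a + b - 1) \<in> set (all_positions a b)" using assms by (auto simp: set_all_positions)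
  then show ?thesis by (simp add: positions_def)
qed

lemma set_positions:
  "set (positions a b) = {(i, j). i < a + b \<and> j < a + b \<and> \<not> (a \<le> i \<and> j < a)} - {(a + b - 1, a + b - 1)}"
  by (simp add: positions_def distinct_all_positions set_all_positions)

lemma distinct_positions: "distinct (positions a b)"
  by (simp add: positions_def distinct_all_positions)

lemma positions_ordered:
  assumes "k < l" "l < length (positions a b)" "positions a b ! k = (i, j)" "positions a b ! l = (i', j')"
  shows "int i - int j \<le> int i' - int j'"
proof -
  have "sorted (map (\<lambda>(i, j). int i - int j) (positions a b))" unfolding positions_def by simp
  from sorted_nth_mono[OF this, of k l] show ?thesis using assms by simp
qed

lemma trace_free_unit_carrier [simp]: "trace_free_unit n p \<in> carrier_mat n n"
  by (simp add: trace_free_unit_def)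

lemma trace_free_unit_parabolic:
  assumes "p \<in> set (positions a b)"
  shows "trace_free_unit (a + b) p \<in> carrier (parabolic a b)"
proof -
  obtain i j where p: "p = (i, j)" by force
  have ij: "i < a + b" "j < a + b" "\<not> (a \<le> i \<and> j < a)" using assms by (auto simp: set_positions p)
  have "mat_trace (trace_free_unit (a + b) p) = (\<Sum>l<a + b. (if l = i then (if i = j then 1 else 0) else 0)
      - (if l = a + b - 1 then (if i = j then 1 else 0) else 0))"
    unfolding mat_trace_sum[OF trace_free_unit_carrier]
    by (rule sum.cong) (auto simp: trace_free_unit_def p)
  also have "\<dots> = 0" using ij by (simp add: sum_subtractf)
  finally have "mat_trace (trace_free_unit (a + b) p) = 0" .
  moreover have "trace_free_unit (a + b) p \<in> block_upper a b"
    using ij by (auto simp: block_upper_def trace_free_unit_def p)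
  ultimately show ?thesis by (simp add: parabolic_carrier)
qed

lemma trace_free_unit_entry:
  assumes "q \<in> set (positions a b)"
  shows "trace_free_unit (a + b) p $$ q = (if q = p then 1 else 0)"
proof -
  obtain i j where q: "q = (i, j)" by force
  have "i < a + b" "j < a + b" "(i, j) \<noteq> (a + b - 1, a + b - 1)" using assms unfolding q set_positions by blast+
  then show ?thesis unfolding trace_free_unit_def q by simp
qed

lemma parabolic_eqI:
  assumes x: "x \<in> carrier (parabolic a b)" and y: "y \<in> carrier (parabolic a b)"
    and eq: "\<And>p. p \<in> set (positions a b) \<Longrightarrow> x $$ p = y $$ p"
  shows "x = y"
proof (rule eq_matI)
  note X = parabolic_mem[OF x] and Y = parabolic_mem[OF y]
  fix i j assume "i < dim_row y" "j < dim_col y"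
  then have ij: "i < a + b" "j < a + b" using Y(2) by auto
  have off: "x $$ (i, j) = y $$ (i, j)" if "i < a + b" "j < a + b" "(i, j) \<noteq> (a + b - 1, a + b - 1)" for i j
  proof (cases "a \<le> i \<and> j < a")
    case True
    then show ?thesis using block_upper_zero[OF X(1), of i j] block_upper_zero[OF Y(1), of i j] that by simp
  next
    case False
    then have "(i, j) \<in> set (positions a b)" using that unfolding set_positions by blast
    then show ?thesis by (rule eq)
  qed
  show "x $$ (i, j) = y $$ (i, j)"
  proof (cases "(i, j) = (a + b - 1, a + b - 1)")
    case True
    have split: "(\<Sum>l<a + b. z $$ (l, l)) = z $$ (i, i) + (\<Sum>l\<in>{..<a + b} - {i}. z $$ (l, l))" for z :: "complex mat"
      using ij by (intro sum.remove) auto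
    have "(\<Sum>l\<in>{..<a + b} - {i}. x $$ (l, l)) = (\<Sum>l\<in>{..<a + b} - {i}. y $$ (l, l))"
      using True by (intro sum.cong) (auto intro: off)
    then have "x $$ (i, i) = y $$ (i, i)"
      using X(3) Y(3) unfolding mat_trace_sum[OF X(2)] mat_trace_sum[OF Y(2)] split
      by (metis add_right_cancel)
    then show ?thesis using True by simp
  qed (use off ij in blast)
qed (use parabolic_mem(2)[OF x] parabolic_mem(2)[OF y] in auto)

lemma parabolic_conjugate:
  assumes x: "x \<in> carrier (parabolic a b)"
    and g: "g \<in> block_upper a b" and g': "g' \<in> block_upper a b" and inv: "g' * g = 1\<^sub>m (a + b)"
  shows "g * x * g' \<in> carrier (parabolic a b)"
proof -
  note X = parabolic_mem[OF x]
  note car = X(2) block_upper_carrier[OF g] block_upper_carrier[OF g']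
  have "mat_trace (g * x * g') = mat_trace (g' * (g * x))"
    using car by (intro mat_trace_mult_commute[of _ "a + b"]) auto
  also have "g' * (g * x) = (g' * g) * x" using car by (intro assoc_mult_mat[symmetric]) auto
  also have "mat_trace \<dots> = 0" using car X(3) unfolding inv by simp
  finally show ?thesis using X(1) g g' by (simp add: parabolic_carrier block_upper_mult)
qed

lemma linear_endo_conjugate:
  assumes g: "g \<in> block_upper a b" and g': "g' \<in> block_upper a b" and inv: "g' * g = 1\<^sub>m (a + b)"
  shows "linear_endo (parabolic a b) (\<lambda>x. g * x * g')"
proof (intro conjI ballI allI; (unfold parabolic_simps)?)
  let ?n = "a + b"
  note car = block_upper_carrier[OF g] block_upper_carrier[OF g']
  show "(\<lambda>x. g * x * g') \<in> carrier (parabolic a b) \<rightarrow> carrier (parabolic a b)"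
    using parabolic_conjugate[OF _ g g' inv] by blast
  fix x assume "x \<in> carrier (parabolic a b)"
  note x = parabolic_mem(2)[OF this]
  show "g * (c \<cdot>\<^sub>m x) * g' = c \<cdot>\<^sub>m (g * x * g')" for c
    using car x by (simp add: mult_smult_distrib[of _ ?n ?n _ ?n] mult_smult_assoc_mat[of _ ?n ?n _ ?n])
  fix y assume "y \<in> carrier (parabolic a b)"
  note y = parabolic_mem(2)[OF this]
  show "g * (x + y) * g' = g * x * g' + g * y * g'"
    using car x y by (simp add: mult_add_distrib_mat[of _ ?n ?n _ ?n] add_mult_distrib_mat[of _ ?n ?n _ _ ?n])
qed

lemma linear_functional_entry:
  "i < a + b \<Longrightarrow> j < a + b \<Longrightarrow> linear_functional (parabolic a b) (\<lambda>x. x $$ (i, j))"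
  unfolding linear_functional_def parabolic_simps by (auto dest!: parabolic_mem(2))

lemma linear_endo_commutator:
  assumes h: "h \<in> block_upper a b"
  shows "linear_endo (parabolic a b) (commutator h)"
proof (intro conjI ballI allI; (unfold parabolic_simps)?)
  let ?n = "a + b"
  note hc = block_upper_carrier[OF h]
  show "commutator h \<in> carrier (parabolic a b) \<rightarrow> carrier (parabolic a b)"
  proof
    fix x assume "x \<in> carrier (parabolic a b)"
    note x = parabolic_mem[OF this]
    show "commutator h x \<in> carrier (parabolic a b)"
      using mat_trace_commutator[OF hc x(2)] block_upper_mult(1)[OF h x(1)] block_upper_mult(1)[OF x(1) h]
      by (simp add: parabolic_carrier commutator_def block_upper_linear)
  qed
  fix x assume "x \<in> carrier (parabolic a b)"
  note x = parabolic_mem(2)[OF this]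
  show "commutator h (c \<cdot>\<^sub>m x) = c \<cdot>\<^sub>m commutator h x" for c
    unfolding commutator_def using hc x
    by (simp add: mult_smult_distrib[of _ ?n ?n _ ?n] mult_smult_assoc_mat[of _ ?n ?n _ ?n])
      (intro eq_matI, auto simp: algebra_simps)
  fix y assume "y \<in> carrier (parabolic a b)"
  note y = parabolic_mem(2)[OF this]
  show "commutator h (x + y) = commutator h x + commutator h y"
    unfolding commutator_def using hc x y
    by (simp add: mult_add_distrib_mat[of _ ?n ?n _ ?n] add_mult_distrib_mat[of _ ?n ?n _ _ ?n])
      (intro eq_matI, auto)
qed

text \<open>The basis of traceless units, conjugated by \<open>g\<close> with inverse \<open>g'\<close>.\<close>

definition conjugate_basis :: "nat \<Rightarrow> nat \<Rightarrow> complex mat \<Rightarrow> complex mat \<Rightarrow> complex mat list" where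
  "conjugate_basis a b g g' = map (\<lambda>p. g * trace_free_unit (a + b) p * g') (positions a b)"

lemma conj_conj_inverse:
  fixes g :: "complex mat"
  assumes "g \<in> carrier_mat n n" "g' \<in> carrier_mat n n" "x \<in> carrier_mat n n" "g' * g = 1\<^sub>m n"
  shows "g' * (g * x * g') * g = x"
proof -
  have "g' * (g * x * g') * g = (g' * g) * x * (g' * g)"
    using assms(1-3) by (simp add: assoc_mult_mat[of _ n n _ n _ n])
  also have "\<dots> = x" using assms(3) unfolding assms(4) by simp
  finally show ?thesis .
qed

text \<open>The coordinates of \<open>x\<close> in this basis are the entries of \<open>g' x g\<close> at the basis positions: these
  determine a traceless block upper triangular matrix.\<close>

lemma conjugate_basis:
  assumes g: "g \<in> block_upper a b" and g': "g' \<in> block_upper a b"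
    and inv: "g * g' = 1\<^sub>m (a + b)" "g' * g = 1\<^sub>m (a + b)"
  shows "ordered_basis (parabolic a b) (conjugate_basis a b g g')"
    "\<And>x. x \<in> carrier (parabolic a b) \<Longrightarrow>
       x = comb (parabolic a b) (conjugate_basis a b g g') (\<lambda>k. (g' * x * g) $$ (positions a b ! k))"
proof -
  let ?V = "parabolic a b" and ?bs = "conjugate_basis a b g g'" and ?ps = "positions a b"
  note vs = vectorspace_parabolic[of a b]
  note car = block_upper_carrier[OF g] block_upper_carrier[OF g']
  have len: "length ?bs = length ?ps" by (simp add: conjugate_basis_def)
  have sub: "set ?bs \<subseteq> carrier ?V"
    using parabolic_conjugate[OF trace_free_unit_parabolic g g' inv(2)] by (auto simp: conjugate_basis_def)
  have functional: "linear_functional ?V (\<lambda>x. (g' * x * g) $$ p)" if "p \<in> set ?ps" for p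
    using linear_functional_endo[OF vs linear_functional_entry linear_endo_conjugate[OF g' g inv(1)], of "fst p" "snd p"] that
    by (cases p) (auto simp: set_positions)
  have coord: "(g' * comb ?V ?bs c * g) $$ (?ps ! k) = c k" if k: "k < length ?ps" for c k
  proof -
    have mem: "?ps ! k \<in> set ?ps" using k by simp
    have "(g' * comb ?V ?bs c * g) $$ (?ps ! k) = (\<Sum>l<length ?bs. c l * (g' * (?bs ! l) * g) $$ (?ps ! k))"
      by (rule linear_functional_comb[OF vs functional[OF mem] sub])
    also have "\<dots> = (\<Sum>l<length ?ps. if l = k then c l else 0)"
    proof (rule sum.cong)
      fix l assume "l \<in> {..<length ?ps}"
      then have l: "l < length ?ps" by simp
      have "g' * (?bs ! l) * g = trace_free_unit (a + b) (?ps ! l)"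
        using l conj_conj_inverse[OF car trace_free_unit_carrier inv(2)] by (simp add: conjugate_basis_def)
      then show "c l * (g' * (?bs ! l) * g) $$ (?ps ! k) = (if l = k then c l else 0)"
        using nth_eq_iff_index_eq[OF distinct_positions k l] by (auto simp: trace_free_unit_entry[OF mem])
    qed (simp add: len)
    also have "\<dots> = c k" using k by simp
    finally show ?thesis .
  qed
  show span: "x = comb ?V ?bs (\<lambda>k. (g' * x * g) $$ (?ps ! k))" if x: "x \<in> carrier ?V" for x
  proof -
    let ?y = "comb ?V ?bs (\<lambda>k. (g' * x * g) $$ (?ps ! k))"
    have y: "?y \<in> carrier ?V" by (rule comb_closed[OF vs sub])
    have "g' * x * g = g' * ?y * g"
    proof (rule parabolic_eqI)
      fix p assume "p \<in> set ?ps"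
      then obtain k where "k < length ?ps" "p = ?ps ! k" by (auto simp: in_set_conv_nth)
      then show "(g' * x * g) $$ p = (g' * ?y * g) $$ p" using coord by simp
    qed (rule parabolic_conjugate[OF _ g' g inv(1)], fact)+
    then have "g * (g' * x * g) * g' = g * (g' * ?y * g) * g'" by simp
    then show ?thesis
      using conj_conj_inverse[OF car(2,1) parabolic_mem(2)[OF x] inv(1)]
        conj_conj_inverse[OF car(2,1) parabolic_mem(2)[OF y] inv(1)] by simp
  qed
  show "ordered_basis ?V ?bs"
  proof (rule ordered_basisI[OF vs sub])
    show "\<exists>c. x = comb ?V ?bs c" if "x \<in> carrier ?V" for x using span[OF that] by blast
    fix c i assume c: "comb ?V ?bs c = \<zero>\<^bsub>?V\<^esub>" and i: "i < length ?bs"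
    have "?ps ! i \<in> set ?ps" using i len by simp
    from linear_functional_zero[OF vs functional[OF this]] show "c i = 0"
      using coord[of i c] i len unfolding c by simp
  qed
qed

lemma trace_free_unit_index:
  assumes "r \<le> N" "c \<le> N"
  shows "trace_free_unit (Suc N) (i, j) $$ (r, c)
    = (if r = i then if c = j then 1 else 0 else 0) - (if r = N then if i = j \<and> c = N then 1 else 0 else 0)"
  using assms by (simp add: trace_free_unit_def)

lemma commutator_trace_free_unit_entry:
  assumes T: "T \<in> carrier_mat (Suc N) (Suc N)" and ij: "i \<le> N" "j \<le> N" and kl: "k \<le> N" "l \<le> N"
  shows "commutator T (trace_free_unit (Suc N) (i, j)) $$ (k, l) =
     (if l = j then T $$ (k, i) else 0) - (if k = i then T $$ (j, l) else 0)
     - (if i = j then (if l = N then T $$ (k, N) else 0) - (if k = N then T $$ (N, l) else 0) else 0)"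
proof -
  let ?E = "trace_free_unit (Suc N) (i, j)"
  have kl': "k < Suc N" "l < Suc N" using kl by simp_all
  have "(T * ?E) $$ (k, l) = (\<Sum>m<Suc N. (if m = i then T $$ (k, m) * (if l = j then 1 else 0) else 0)
      - (if m = N then T $$ (k, m) * (if i = j \<and> l = N then 1 else 0) else 0))"
    unfolding mult_entry[OF T trace_free_unit_carrier kl']
  proof (rule sum.cong[OF refl])
    fix m assume "m \<in> {..<Suc N}"
    then have "m \<le> N" by simp
    then show "T $$ (k, m) * ?E $$ (m, l) = (if m = i then T $$ (k, m) * (if l = j then 1 else 0) else 0)
      - (if m = N then T $$ (k, m) * (if i = j \<and> l = N then 1 else 0) else 0)"
      unfolding trace_free_unit_index[OF \<open>m \<le> N\<close> kl(2)] right_diff_distrib by simp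
  qed
  then have 1: "(T * ?E) $$ (k, l) = (if l = j then T $$ (k, i) else 0) - (if i = j \<and> l = N then T $$ (k, N) else 0)"
    using ij by (simp add: sum_subtractf del: sum.lessThan_Suc index_mult_mat(1))
  have "(?E * T) $$ (k, l) = (\<Sum>m<Suc N. (if m = j then (if k = i then 1 else 0) * T $$ (m, l) else 0)
      - (if m = N then (if i = j \<and> k = N then 1 else 0) * T $$ (m, l) else 0))"
    unfolding mult_entry[OF trace_free_unit_carrier T kl']
  proof (rule sum.cong[OF refl])
    fix m assume "m \<in> {..<Suc N}"
    then have "m \<le> N" by simp
    then show "?E $$ (k, m) * T $$ (m, l) = (if m = j then (if k = i then 1 else 0) * T $$ (m, l) else 0)
      - (if m = N then (if i = j \<and> k = N then 1 else 0) * T $$ (m, l) else 0)"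
      unfolding trace_free_unit_index[OF kl(1) \<open>m \<le> N\<close>] left_diff_distrib by simp
  qed
  then have 2: "(?E * T) $$ (k, l) = (if k = i then T $$ (j, l) else 0) - (if i = j \<and> k = N then T $$ (N, l) else 0)"
    using ij by (simp add: sum_subtractf del: sum.lessThan_Suc index_mult_mat(1))
  have "commutator T ?E $$ (k, l) = (T * ?E) $$ (k, l) - (?E * T) $$ (k, l)"
    unfolding commutator_def using T kl'
    by (subst index_minus_mat(1)) (simp_all add: trace_free_unit_def del: index_mult_mat(1))
  then show ?thesis unfolding 1 2 by simp
qed

lemma proots_operator_char_poly_commutator:
  assumes h: "h \<in> block_upper a b"
    and g: "g \<in> block_upper a b" and g': "g' \<in> block_upper a b"
    and inv: "g * g' = 1\<^sub>m (a + b)" "g' * g = 1\<^sub>m (a + b)"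
    and T: "upper_triangular (g' * h * g)" (is "upper_triangular ?T")
  shows "proots (operator_char_poly (parabolic a b) (commutator h))
     = image_mset (\<lambda>(i, j). ?T $$ (i, i) - ?T $$ (j, j)) (mset (positions a b))"
proof -
  let ?V = "parabolic a b" and ?bs = "conjugate_basis a b g g'" and ?ps = "positions a b" and ?n = "a + b"
  note vs = vectorspace_parabolic[of a b]
  note car = block_upper_carrier[OF g] block_upper_carrier[OF g'] block_upper_carrier[OF h]
  note basis = conjugate_basis[OF g g' inv]
  have Tc: "?T \<in> carrier_mat ?n ?n" using car by auto
  define M where "M = mat (length ?ps) (length ?ps) (\<lambda>(k, l). commutator ?T (trace_free_unit ?n (?ps ! l)) $$ (?ps ! k))"
  have M: "M \<in> carrier_mat (length ?ps) (length ?ps)" by (simp add: M_def)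
  have "represents ?V (commutator h) ?bs M"
    unfolding represents_comb[OF vs]
  proof (intro conjI allI impI)
    fix l assume "l < length ?bs"
    then have l: "l < length ?ps" by (simp add: conjugate_basis_def)
    have bl: "?bs ! l \<in> carrier ?V"
      using ordered_basis_carrier[OF vs basis(1)] \<open>l < length ?bs\<close> nth_mem by blast
    have "g' * commutator h (?bs ! l) * g = commutator ?T (g' * (?bs ! l) * g)"
      using commutator_conjugate[OF car(3) parabolic_mem(2)[OF bl] car(1,2) inv(1)] by simp
    also have "g' * (?bs ! l) * g = trace_free_unit ?n (?ps ! l)"
      using l conj_conj_inverse[OF car(1,2) trace_free_unit_carrier inv(2)] by (simp add: conjugate_basis_def)
    finally have eq: "g' * commutator h (?bs ! l) * g = commutator ?T (trace_free_unit ?n (?ps ! l))" .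
    have "commutator h (?bs ! l) \<in> carrier ?V" using linear_endo_commutator[OF h] bl by blast
    from basis(2)[OF this] have "commutator h (?bs ! l) = comb ?V ?bs (\<lambda>k. commutator ?T (trace_free_unit ?n (?ps ! l)) $$ (?ps ! k))"
      unfolding eq .
    also have "\<dots> = comb ?V ?bs (\<lambda>k. M $$ (k, l))"
      by (rule comb_cong[OF vs ordered_basis_carrier[OF vs basis(1)]]) (use l in \<open>simp add: M_def conjugate_basis_def\<close>)
    finally show "commutator h (?bs ! l) = comb ?V ?bs (\<lambda>k. M $$ (k, l))" .
  qed (use M in \<open>simp add: conjugate_basis_def\<close>)
  then have poly: "operator_char_poly ?V (commutator h) = char_poly M"
    by (rule operator_char_poly_eq[OF vs linear_endo_commutator[OF h] basis(1)])
  have pos: "i < ?n" "j < ?n" "(i, j) \<noteq> (?n - 1, ?n - 1)" if "k < length ?ps" "?ps ! k = (i, j)" for k i j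
    using nth_mem[OF that(1)] unfolding that(2) set_positions by blast+
  have entry: "commutator ?T (trace_free_unit ?n (i, j)) $$ (k, l) =
      (if (k, l) = (i, j) then ?T $$ (i, i) - ?T $$ (j, j) else 0)"
    if ij: "i < ?n" "j < ?n" and kl: "k < ?n" "l < ?n" and
      last: "(i, j) \<noteq> (?n - 1, ?n - 1)" "(k, l) \<noteq> (?n - 1, ?n - 1)"
      and ord: "int i - int j \<le> int k - int l" for i j k l
  proof -
    define N where "N = ?n - 1"
    have n: "?n = Suc N" using ij unfolding N_def by simp
    have tri: "?T $$ (i, j) = 0" if "j < i" "i \<le> N" for i j
      using upper_triangularD[OF T that(1)] that(2) Tc n by auto
    have le: "i \<le> N" "j \<le> N" "k \<le> N" "l \<le> N" using ij kl n by simp_all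
    have neq: "\<not> (k = N \<and> l = N)" using last(2) unfolding N_def by simp
    have 1: "?T $$ (k, i) = 0" if "l = j" "k \<noteq> i" using tri[of i k] ord that le by simp
    have 2: "?T $$ (j, l) = 0" if "k = i" "l \<noteq> j" using tri[of l j] ord that le by simp
    have 3: False if "i = j" "l = N" using ord that le neq by simp
    have 4: "?T $$ (N, l) = 0" if "k = N" using tri[of l N] that le neq by simp
    have "commutator ?T (trace_free_unit ?n (i, j)) $$ (k, l) =
       (if l = j then ?T $$ (k, i) else 0) - (if k = i then ?T $$ (j, l) else 0)
       - (if i = j then (if l = N then ?T $$ (k, N) else 0) - (if k = N then ?T $$ (N, l) else 0) else 0)"
      using commutator_trace_free_unit_entry[OF Tc[unfolded n] le] unfolding n .
    also have "\<dots> = (if l = j then ?T $$ (k, i) else 0) - (if k = i then ?T $$ (j, l) else 0)"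
      using 3 4 by (auto split: if_splits)
    also have "\<dots> = (if (k, l) = (i, j) then ?T $$ (i, i) - ?T $$ (j, j) else 0)"
      using 1 2 by (auto split: if_splits)
    finally show ?thesis .
  qed
  have "upper_triangular M"
  proof (rule upper_triangularI)
    fix k l assume kl: "l < k" "k < dim_row M"
    then have k: "k < length ?ps" and l: "l < length ?ps" using M by auto
    obtain i j i' j' where p: "?ps ! l = (i, j)" "?ps ! k = (i', j')" by force
    have "(i', j') \<noteq> (i, j)" using nth_eq_iff_index_eq[OF distinct_positions k l] kl p by auto
    then show "M $$ (k, l) = 0"
      using entry[OF pos(1,2)[OF l p(1)] pos(1,2)[OF k p(2)] pos(3)[OF l p(1)] pos(3)[OF k p(2)] positions_ordered[OF kl(1) k p]] k l
      by (auto simp: M_def p)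
  qed
  then have "proots (operator_char_poly ?V (commutator h)) = mset (diag_mat M)"
    unfolding poly by (rule proots_char_poly_upper_triangular[OF M])
  also have "diag_mat M = map (\<lambda>(i, j). ?T $$ (i, i) - ?T $$ (j, j)) ?ps"
  proof (rule nth_equalityI)
    fix k assume "k < length (diag_mat M)"
    then have k: "k < length ?ps" using M by (simp add: diag_mat_def)
    obtain i j where p: "?ps ! k = (i, j)" by force
    show "diag_mat M ! k = map (\<lambda>(i, j). ?T $$ (i, i) - ?T $$ (j, j)) ?ps ! k"
      using entry[OF pos(1,2)[OF k p] pos(1,2)[OF k p] pos(3)[OF k p] pos(3)[OF k p] order.refl] k M
      by (simp add: diag_mat_def M_def p)
  qed (use M in \<open>simp add: diag_mat_def\<close>)
  finally show ?thesis by simp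
qed

lemma mset_map_product:
  "mset (map (\<lambda>(i, j). t i - t j) (List.product xs ys)) = diff_mset (mset (map t xs)) (mset (map t ys))"
  by (induction xs) (simp_all add: diff_mset_add_mset_left image_mset.compositionality comp_def)

text \<open>The additional \<open>0\<close> on the left-hand side stands for the last diagonal position.\<close>

lemma proots_commutator_block_upper:
  assumes n: "0 < a + b" and h: "h \<in> block_upper a b"
  defines "P \<equiv> proots (char_poly (upper_left_block a h))" and "Q \<equiv> proots (char_poly (lower_right_block a b h))"
  shows "add_mset 0 (proots (operator_char_poly (parabolic a b) (commutator h)))
    = diff_mset P P + diff_mset Q Q + diff_mset P Q"
proof -
  let ?X = "upper_left_block a h" and ?Y = "lower_right_block a b h" and ?Z = "upper_right_block a b h"
  obtain B1 P1 Q1 where 1: "upper_triangular B1" "similar_mat_wit ?X B1 P1 Q1" "P = mset (diag_mat B1)"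
    using complex_schur[OF block_carrier(1)] unfolding P_def by metis
  obtain B2 P2 Q2 where 2: "upper_triangular B2" "similar_mat_wit ?Y B2 P2 Q2" "Q = mset (diag_mat B2)"
    using complex_schur[OF block_carrier(3)] unfolding Q_def by metis
  note D1 = similar_mat_witD2[OF block_carrier(1) 1(2)] and D2 = similar_mat_witD2[OF block_carrier(3) 2(2)]
  have Zc: "?Z \<in> carrier_mat a b" by simp
  define U where "U = Q1 * ?Z * P2"
  have U: "U \<in> carrier_mat a b" using D1 D2 Zc unfolding U_def by auto
  have ZP: "?Z * P2 \<in> carrier_mat a b" by (rule mult_carrier_mat[OF Zc D2(6)])
  have "P1 * U = (P1 * Q1) * (?Z * P2)"
    unfolding U_def assoc_mult_mat[OF D1(7) Zc D2(6)] using D1(6,7) ZP by (intro assoc_mult_mat[symmetric])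
  then have "P1 * U * Q2 = ?Z * P2 * Q2" unfolding D1(1) left_mult_one_mat[OF ZP] by simp
  also have "\<dots> = ?Z * (P2 * Q2)" by (rule assoc_mult_mat[OF Zc D2(6,7)])
  finally have Z: "?Z = P1 * U * Q2" unfolding D2(1) using Zc by simp
  define g g' T where "g = four_block_mat P1 (0\<^sub>m a b) (0\<^sub>m b a) P2"
    and "g' = four_block_mat Q1 (0\<^sub>m a b) (0\<^sub>m b a) Q2" and "T = four_block_mat B1 U (0\<^sub>m b a) B2"
  have "similar_mat_wit (four_block_mat ?X ?Z (0\<^sub>m b a) ?Y) T g g'"
    unfolding g_def g'_def T_def
    by (rule similar_mat_wit_four_block[OF 1(2) 2(2) Z]) (use U D1 D2 in auto)
  then have wit: "similar_mat_wit h T g g'" using block_upper_eq_four_block[OF h] by simp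
  note D = similar_mat_witD2[OF block_upper_carrier[OF h] wit]
  note D' = similar_mat_witD2[OF D(5) similar_mat_wit_sym[OF wit]]
  have gb: "g \<in> block_upper a b" "g' \<in> block_upper a b"
    unfolding g_def g'_def using D1 D2 by (auto intro!: four_block_in_block_upper)
  have T: "upper_triangular T" unfolding T_def by (rule upper_triangular_four_block[OF D1(5) D2(5) 1(1) 2(1)])
  define t where "t = (\<lambda>i. T $$ (i, i))"
  have t: "map t [0..<a] = diag_mat B1" "map t [a..<a + b] = diag_mat B2"
    unfolding t_def T_def diag_mat_def using D1(5) D2(5) by (auto intro!: nth_equalityI)
  have "proots (operator_char_poly (parabolic a b) (commutator h)) = image_mset (\<lambda>(i, j). t i - t j) (mset (positions a b))"
    using proots_operator_char_poly_commutator[OF h gb D(1,2)] T unfolding D'(3)[symmetric] t_def by blast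
  then have "add_mset 0 (proots (operator_char_poly (parabolic a b) (commutator h)))
      = image_mset (\<lambda>(i, j). t i - t j) (add_mset (a + b - 1, a + b - 1) (mset (positions a b)))" by simp
  also have "\<dots> = mset (map (\<lambda>(i, j). t i - t j) (all_positions a b))"
    unfolding mset_positions[OF n] by simp
  also have "\<dots> = diff_mset P P + diff_mset Q Q + diff_mset P Q"
    unfolding all_positions_def map_append mset_append mset_map_product t 1(3) 2(3) by (simp add: add.assoc)
  finally show ?thesis .
qed

section \<open>Functionals as trace pairings\<close>

lemma mat_trace_mult_trace_free_unit:
  assumes W: "W \<in> carrier_mat (Suc N) (Suc N)" and ij: "i \<le> N" "j \<le> N"
  shows "mat_trace (W * trace_free_unit (Suc N) (i, j)) = W $$ (j, i) - (if i = j then W $$ (N, N) else 0)"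
proof -
  let ?E = "trace_free_unit (Suc N) (i, j)"
  have inner: "(\<Sum>c<Suc N. W $$ (r, c) * ?E $$ (c, r))
      = (if r = j then W $$ (r, i) else 0) - (if r = N then if i = j then W $$ (r, N) else 0 else 0)"
    if r: "r \<le> N" for r
  proof -
    have "(\<Sum>c<Suc N. W $$ (r, c) * ?E $$ (c, r))
        = (\<Sum>c<Suc N. (if c = i then W $$ (r, c) * (if r = j then 1 else 0) else 0)
            - (if c = N then W $$ (r, c) * (if i = j \<and> r = N then 1 else 0) else 0))"
    proof (rule sum.cong[OF refl])
      fix c assume "c \<in> {..<Suc N}"
      then have "c \<le> N" by simp
      then show "W $$ (r, c) * ?E $$ (c, r) = (if c = i then W $$ (r, c) * (if r = j then 1 else 0) else 0)
            - (if c = N then W $$ (r, c) * (if i = j \<and> r = N then 1 else 0) else 0)"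
        unfolding trace_free_unit_index[OF \<open>c \<le> N\<close> r] right_diff_distrib by simp
    qed
    then show ?thesis using ij by (simp add: sum_subtractf del: sum.lessThan_Suc)
  qed
  have "mat_trace (W * ?E) = (\<Sum>r<Suc N. (if r = j then W $$ (r, i) else 0) - (if r = N then if i = j then W $$ (r, N) else 0 else 0))"
    unfolding mat_trace_mult[OF W trace_free_unit_carrier]
    by (rule sum.cong[OF refl], rule inner) simp
  then show ?thesis using ij by (simp add: sum_subtractf del: sum.lessThan_Suc)
qed

text \<open>A traceless matrix is orthogonal to the parabolic algebra under the trace form iff it lies in the
  upper right block: off the diagonal this is read off from matrix units, and on the diagonal all entries
  are equal, hence zero.\<close>

lemma trace_pairing_zero_iff:
  assumes n: "0 < a + b" and W: "W \<in> carrier_mat (a + b) (a + b)" and tr: "mat_trace W = 0"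
  shows "W \<in> upper_right a b \<longleftrightarrow> (\<forall>y\<in>carrier (parabolic a b). mat_trace (W * y) = 0)"
proof
  assume U: "W \<in> upper_right a b"
  show "\<forall>y\<in>carrier (parabolic a b). mat_trace (W * y) = 0"
  proof
    fix y assume "y \<in> carrier (parabolic a b)"
    then have "W * y \<in> upper_right a b" using upper_right_ideal(2)[OF _ U] parabolic_mem(1) by blast
    then show "mat_trace (W * y) = 0"
      using mat_trace_sum[OF upper_right_carrier] upper_right_zero by simp
  qed
next
  assume zero: "\<forall>y\<in>carrier (parabolic a b). mat_trace (W * y) = 0"
  define N where "N = a + b - 1"
  have n: "a + b = Suc N" using n unfolding N_def by simp
  have pair: "mat_trace (W * trace_free_unit (a + b) (i, j)) = W $$ (j, i) - (if i = j then W $$ (N, N) else 0)"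
    if ij: "i < a + b" "j < a + b" for i j
    using mat_trace_mult_trace_free_unit[OF W[unfolded n]] ij unfolding n by simp
  have entry: "W $$ (j, i) = (if i = j then W $$ (N, N) else 0)" if ij: "i < a + b" "j < a + b" "\<not> (a \<le> i \<and> j < a)" for i j
  proof (cases "(i, j) = (N, N)")
    case False
    then have "(i, j) \<in> set (positions a b)" using ij unfolding set_positions N_def by blast
    then show ?thesis using zero trace_free_unit_parabolic pair[OF ij(1,2)] by fastforce
  qed simp
  have "(\<Sum>i<a + b. W $$ (i, i)) = (\<Sum>i<a + b. W $$ (N, N))"
    by (rule sum.cong) (auto intro: entry[THEN trans])
  then have "W $$ (N, N) = 0" using tr n unfolding mat_trace_sum[OF W] by (simp del: sum.lessThan_Suc of_nat_Suc)
  then show "W \<in> upper_right a b"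
    unfolding upper_right_def using W entry by auto
qed

lemma mat_trace_commutator_mult:
  assumes "F \<in> carrier_mat n n" "x \<in> carrier_mat n n" "y \<in> carrier_mat n n"
  shows "mat_trace (F * commutator x y) = mat_trace (commutator F x * y)"
proof -
  have "F * commutator x y = F * x * y - F * y * x"
    unfolding commutator_def using assms
    by (subst mult_minus_distrib_mat[of _ n n _ n]) (auto simp: assoc_mult_mat[of _ n n _ n _ n])
  moreover have "commutator F x * y = F * x * y - x * F * y"
    unfolding commutator_def using assms by (subst minus_mult_distrib_mat[of _ n n _ _ n]) auto
  moreover have "mat_trace (F * y * x) = mat_trace (x * F * y)"
    using mat_trace_mult_commute[of "F * y" n x] assms by (simp add: assoc_mult_mat[of _ n n _ n _ n])
  ultimately show ?thesis using assms by (simp add: mat_trace_diff[of _ n])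
qed

lemma linear_functional_trace:
  assumes F: "F \<in> carrier_mat (a + b) (a + b)"
  shows "linear_functional (parabolic a b) (\<lambda>x. mat_trace (F * x))"
  unfolding linear_functional_def parabolic_simps
proof (intro conjI ballI allI)
  let ?n = "a + b"
  fix x assume "x \<in> carrier (parabolic a b)"
  note x = parabolic_mem(2)[OF this]
  show "mat_trace (F * (c \<cdot>\<^sub>m x)) = c * mat_trace (F * x)" for c
    using F x by (simp add: mult_smult_distrib[of _ ?n ?n _ ?n] mat_trace_smult[of _ ?n])
  fix y assume "y \<in> carrier (parabolic a b)"
  note y = parabolic_mem(2)[OF this]
  show "mat_trace (F * (x + y)) = mat_trace (F * x) + mat_trace (F * y)"
    using F x y by (simp add: mult_add_distrib_mat[of _ ?n ?n _ ?n] mat_trace_add[of _ ?n])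
qed

text \<open>The entries of \<open>F\<close> are the values on the traceless units; the trace form does not see scalars, and subtracting
  one makes \<open>F\<close> traceless.\<close>

lemma linear_functional_eq_trace:
  assumes n: "0 < a + b" and \<phi>: "linear_functional (parabolic a b) \<phi>"
  obtains F where "F \<in> carrier_mat (a + b) (a + b)" "mat_trace F = 0"
    "\<And>x. x \<in> carrier (parabolic a b) \<Longrightarrow> \<phi> x = mat_trace (F * x)"
proof -
  let ?V = "parabolic a b" and ?n = "a + b" and ?ps = "positions a b"
  note vs = vectorspace_parabolic[of a b]
  define G where "G = mat ?n ?n (\<lambda>(j, i). if (i, j) \<in> set ?ps then \<phi> (trace_free_unit ?n (i, j)) else 0)"
  have G: "G \<in> carrier_mat ?n ?n" by (simp add: G_def)
  define c where "c = mat_trace G / of_nat ?n"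
  define F where "F = G - c \<cdot>\<^sub>m 1\<^sub>m ?n"
  have F: "F \<in> carrier_mat ?n ?n" using G by (simp add: F_def minus_carrier_mat)
  have trF: "mat_trace F = 0"
    unfolding F_def c_def using G n
    by (subst mat_trace_diff[of _ ?n]) (auto simp: mat_trace_smult[of _ ?n] mat_trace_one simp del: of_nat_add)
  have FG: "mat_trace (F * x) = mat_trace (G * x)" if x: "x \<in> carrier ?V" for x
  proof -
    note X = parabolic_mem[OF x]
    have "F * x = G * x - c \<cdot>\<^sub>m x"
      unfolding F_def using G X(2)
      by (subst minus_mult_distrib_mat[of _ ?n ?n _ _ ?n]) (auto simp: mult_smult_assoc_mat[of _ ?n ?n _ ?n])
    then show ?thesis using G X by (simp add: mat_trace_diff[of _ ?n] mat_trace_smult[of _ ?n])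
  qed
  have "\<phi> x = mat_trace (G * x)" if x: "x \<in> carrier ?V" for x
  proof -
    let ?bs = "conjugate_basis a b (1\<^sub>m ?n) (1\<^sub>m ?n)"
    note basis = conjugate_basis[OF block_upper_linear(5) block_upper_linear(5), of a b, simplified]
    note sub = ordered_basis_carrier[OF vs basis(1)]
    have len: "length ?bs = length ?ps" by (simp add: conjugate_basis_def)
    have agree: "\<phi> (?bs ! k) = mat_trace (G * (?bs ! k))" if k: "k < length ?ps" for k
    proof -
      obtain i j where p: "?ps ! k = (i, j)" by force
      have mem: "(i, j) \<in> set ?ps" using k p nth_mem by metis
      then have ij: "i < ?n" "j < ?n" by (auto simp: set_positions)
      have b: "?bs ! k = trace_free_unit ?n (i, j)"
        using k p left_mult_one_mat[OF trace_free_unit_carrier] right_mult_one_mat[OF trace_free_unit_carrier]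
        by (simp add: conjugate_basis_def)
      define N where "N = ?n - 1"
      have nN: "?n = Suc N" using n unfolding N_def by simp
      have GN: "G $$ (N, N) = 0" unfolding G_def nN by (simp add: set_positions nN)
      have "mat_trace (G * trace_free_unit ?n (i, j)) = G $$ (j, i)"
        using mat_trace_mult_trace_free_unit[OF G[unfolded nN]] ij GN unfolding nN by simp
      also have "\<dots> = \<phi> (trace_free_unit ?n (i, j))" using ij mem by (simp add: G_def)
      finally show ?thesis unfolding b by simp
    qed
    obtain c where c: "x = comb ?V ?bs c" using basis(2)[OF x] by blast
    show ?thesis
      unfolding c linear_functional_comb[OF vs \<phi> sub] linear_functional_comb[OF vs linear_functional_trace[OF G] sub]
      by (rule sum.cong) (use agree len in auto)
  qed
  then show ?thesis using that[OF F trF] FG by simp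
qed

lemma commutator_subtract_scalar:
  assumes F: "F \<in> carrier_mat (a + b) (a + b)" and h: "h \<in> carrier_mat (a + b) (a + b)"
  shows "commutator F (h - c \<cdot>\<^sub>m 1\<^sub>m (a + b)) = commutator F h"
proof -
  let ?n = "a + b"
  have "F * (h - c \<cdot>\<^sub>m 1\<^sub>m ?n) = F * h - c \<cdot>\<^sub>m F" "(h - c \<cdot>\<^sub>m 1\<^sub>m ?n) * F = h * F - c \<cdot>\<^sub>m F"
    using F h
    by (simp_all add: mult_minus_distrib_mat[of _ ?n ?n _ ?n] minus_mult_distrib_mat[of _ ?n ?n _ _ ?n]
        mult_smult_distrib[of _ ?n ?n _ ?n] mult_smult_assoc_mat[of _ ?n ?n _ ?n])
  then show ?thesis unfolding commutator_def using F h by (intro eq_matI) auto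
qed

lemma trace_free_part:
  assumes n: "0 < a + b" and h: "h \<in> block_upper a b"
  shows "h - (mat_trace h / of_nat (a + b)) \<cdot>\<^sub>m 1\<^sub>m (a + b) \<in> carrier (parabolic a b)"
  using n block_upper_carrier[OF h] h
  by (auto simp: parabolic_carrier block_upper_linear mat_trace_diff[of _ "a + b"] mat_trace_smult[of _ "a + b"]
      mat_trace_one simp del: of_nat_add)

lemma frobenius_functional_iff_matrix:
  assumes n: "0 < a + b" and F: "F \<in> carrier_mat (a + b) (a + b)"
    and \<phi>: "linear_functional (parabolic a b) \<phi>"
      "\<And>x. x \<in> carrier (parabolic a b) \<Longrightarrow> \<phi> x = mat_trace (F * x)"
  shows "frobenius_functional (parabolic a b) commutator \<phi> \<longleftrightarrow> frobenius_matrix a b F"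
proof -
  let ?V = "parabolic a b" and ?n = "a + b"
  have radical: "(\<forall>y\<in>carrier ?V. \<phi> (commutator x y) = 0) \<longleftrightarrow> commutator F x \<in> upper_right a b"
    if x: "x \<in> carrier ?V" for x
  proof -
    note X = parabolic_mem[OF x]
    have "\<phi> (commutator x y) = mat_trace (commutator F x * y)" if y: "y \<in> carrier ?V" for y
      using \<phi>(2) linear_endo_commutator[OF X(1)] y mat_trace_commutator_mult[OF F X(2) parabolic_mem(2)[OF y]]
      by (simp add: Pi_iff)
    then show ?thesis
      using trace_pairing_zero_iff[OF n commutator_carrier[OF F X(2)] mat_trace_commutator[OF F X(2)]] by simp
  qed
  have weight0: "coadjoint_weight a b F 0 h \<longleftrightarrow> commutator F h \<in> upper_right a b" if h: "h \<in> block_upper a b" for h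
  proof -
    have "commutator F h - 0 \<cdot>\<^sub>m F = commutator F h"
      using F commutator_carrier[OF F block_upper_carrier[OF h]] by (intro eq_matI) auto
    then show ?thesis using h by (simp add: coadjoint_weight_def)
  qed
  show ?thesis
  proof
    assume fr: "frobenius_functional ?V commutator \<phi>"
    show "frobenius_matrix a b F"
      unfolding frobenius_matrix_def
    proof (intro conjI allI impI F)
      fix h assume w: "coadjoint_weight a b F 0 h"
      then have hb: "h \<in> block_upper a b" unfolding coadjoint_weight_def by blast
      note hc = block_upper_carrier[OF hb]
      define c where "c = mat_trace h / of_nat ?n"
      have h0: "h - c \<cdot>\<^sub>m 1\<^sub>m ?n \<in> carrier ?V" unfolding c_def by (rule trace_free_part[OF n hb])
      have "commutator F (h - c \<cdot>\<^sub>m 1\<^sub>m ?n) \<in> upper_right a b"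
        unfolding commutator_subtract_scalar[OF F hc] using w weight0[OF hb] by simp
      then have "h - c \<cdot>\<^sub>m 1\<^sub>m ?n = 0\<^sub>m ?n ?n"
        using fr radical[OF h0] h0 unfolding frobenius_functional_def parabolic_simps by blast
      then have entry: "(h - c \<cdot>\<^sub>m 1\<^sub>m ?n) $$ (i, j) = 0\<^sub>m ?n ?n $$ (i, j)" for i j by simp
      have "h = c \<cdot>\<^sub>m 1\<^sub>m ?n"
      proof (rule eq_matI)
        fix i j assume "i < dim_row (c \<cdot>\<^sub>m 1\<^sub>m ?n)" "j < dim_col (c \<cdot>\<^sub>m 1\<^sub>m ?n)"
        then show "h $$ (i, j) = (c \<cdot>\<^sub>m 1\<^sub>m ?n) $$ (i, j)" using entry[of i j] hc by simp
      qed (use hc in auto)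
      then show "\<exists>c. h = c \<cdot>\<^sub>m 1\<^sub>m ?n" by blast
    qed
  next
    assume fr: "frobenius_matrix a b F"
    show "frobenius_functional ?V commutator \<phi>"
      unfolding frobenius_functional_def parabolic_simps
    proof (intro conjI ballI impI \<phi>(1))
      fix x assume x: "x \<in> carrier ?V" and "\<forall>y\<in>carrier ?V. \<phi> (commutator x y) = 0"
      note X = parabolic_mem[OF x]
      have "coadjoint_weight a b F 0 x" using radical[OF x] weight0[OF X(1)] \<open>\<forall>y\<in>_. _\<close> by simp
      then obtain c where c: "x = c \<cdot>\<^sub>m 1\<^sub>m ?n" using fr unfolding frobenius_matrix_def by blast
      have "c * of_nat ?n = 0" using X(3) unfolding c by (simp add: mat_trace_smult[of _ ?n] mat_trace_one del: of_nat_add)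
      then have "c = 0" using n unfolding mult_eq_0_iff of_nat_eq_0_iff by auto
      then show "x = 0\<^sub>m ?n ?n" unfolding c by (intro eq_matI) auto
    qed
  qed
qed

text \<open>Tracelessness of \<open>F\<close> makes \<open>[F, h] - F\<close> traceless, so that no scalar ambiguity remains.\<close>

lemma principal_element_iff_weight:
  assumes n: "0 < a + b" and F: "F \<in> carrier_mat (a + b) (a + b)" "mat_trace F = 0"
    and \<phi>: "\<And>x. x \<in> carrier (parabolic a b) \<Longrightarrow> \<phi> x = mat_trace (F * x)"
    and h: "h \<in> carrier (parabolic a b)"
  shows "principal_element (parabolic a b) commutator \<phi> h \<longleftrightarrow> coadjoint_weight a b F 1 h"
proof -
  let ?V = "parabolic a b" and ?n = "a + b"
  note H = parabolic_mem[OF h]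
  have C: "commutator F h \<in> carrier_mat ?n ?n" by (rule commutator_carrier[OF F(1) H(2)])
  have "\<phi> (commutator h x) = \<phi> x \<longleftrightarrow> mat_trace ((commutator F h - 1 \<cdot>\<^sub>m F) * x) = 0" if x: "x \<in> carrier ?V" for x
  proof -
    note X = parabolic_mem[OF x]
    have "\<phi> (commutator h x) = mat_trace (commutator F h * x)"
      using \<phi> linear_endo_commutator[OF H(1)] x mat_trace_commutator_mult[OF F(1) H(2) X(2)] by (simp add: Pi_iff)
    moreover have "(commutator F h - 1 \<cdot>\<^sub>m F) * x = commutator F h * x - F * x"
      unfolding one_smult_mat by (rule minus_mult_distrib_mat[OF C F(1) X(2)])
    ultimately show ?thesis using \<phi>[OF x] C F X by (simp add: mat_trace_diff[of _ ?n])
  qed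
  moreover have "mat_trace (commutator F h - 1 \<cdot>\<^sub>m F) = 0"
    unfolding one_smult_mat using mat_trace_diff[OF C F(1)] mat_trace_commutator[OF F(1) H(2)] F(2) by simp
  moreover have "commutator F h - 1 \<cdot>\<^sub>m F \<in> carrier_mat ?n ?n" using F by (simp add: minus_carrier_mat)
  ultimately show ?thesis
    unfolding principal_element_def coadjoint_weight_def using trace_pairing_zero_iff[OF n] H(1) h by simp
qed

lemma coadjoint_weight_one_trace:
  assumes F: "F \<in> carrier_mat (a + b) (a + b)" and w: "coadjoint_weight a b F 1 h"
  shows "mat_trace F = 0"
proof -
  have hc: "h \<in> carrier_mat (a + b) (a + b)" and W: "commutator F h - F \<in> upper_right a b"
    using w block_upper_carrier unfolding coadjoint_weight_def one_smult_mat by auto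
  have "mat_trace (commutator F h - F) = 0"
    using mat_trace_sum[OF upper_right_carrier[OF W]] upper_right_zero[OF W] by simp
  then show ?thesis
    using mat_trace_diff[OF commutator_carrier[OF F hc] F] mat_trace_commutator[OF F hc] by simp
qed

section \<open>The Ooms spectrum\<close>

lemma proots_principal:
  assumes cop: "coprime a b" "0 < a" "0 < b" and F: "frobenius_matrix a b F" and w: "coadjoint_weight a b F 1 h"
  shows "proots (operator_char_poly (parabolic a b) (commutator h)) = image_mset of_int (parabolic_spectrum a b)"
proof -
  obtain P Q where PQ: "principal_pair a b = (P, Q)" by force
  obtain s where s: "has_block_spectra a b h (image_mset (\<lambda>k. of_int k + s) P) (image_mset (\<lambda>k. of_int k + s) Q)"
    using principal_block_spectra[OF cop(1) PQ] F w by blast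
  have hb: "h \<in> block_upper a b" using w unfolding coadjoint_weight_def by blast
  have shift: "image_mset (\<lambda>k. of_int k + s) M = image_mset (\<lambda>x. x + s) (image_mset of_int M)" for M
    by (simp add: image_mset.compositionality comp_def)
  define D where "D = diff_mset P P + diff_mset Q Q + diff_mset P Q"
  have eq: "add_mset 0 (proots (operator_char_poly (parabolic a b) (commutator h))) = image_mset of_int D"
    using proots_commutator_block_upper[OF _ hb] s cop
    unfolding has_block_spectra_def D_def by (simp add: shift diff_mset_shift_both diff_mset_of_int)
  then have "0 \<in># image_mset (of_int :: int \<Rightarrow> complex) D" by (metis union_single_eq_member)
  then have "0 \<in># D" by auto
  then have D: "D = add_mset 0 (parabolic_spectrum a b)"
    unfolding parabolic_spectrum_def PQ D_def by simp
  show ?thesis using eq unfolding D by simp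
qed

text \<open>A Frobenius functional exists, and all of them give the same spectrum; so the definite description
  in the definition of the Ooms spectrum is proper.\<close>

lemma ooms_spectrum_parabolic:
  assumes cop: "coprime a b" "0 < a" "0 < b"
  shows "ooms_spectrum (parabolic a b) commutator = image_mset of_int (parabolic_spectrum a b)"
  unfolding ooms_spectrum_def
proof (rule the_equality)
  let ?V = "parabolic a b" and ?n = "a + b"
  have n: "0 < ?n" using cop by simp
  obtain P Q where PQ: "principal_pair a b = (P, Q)" by force
  obtain F h' where F: "frobenius_matrix a b F" and w: "coadjoint_weight a b F 1 h'"
    using principal_block_spectra[OF cop(1) PQ] by blast
  have Fc: "F \<in> carrier_mat ?n ?n" using F unfolding frobenius_matrix_def by simp
  have hb: "h' \<in> block_upper a b" using w unfolding coadjoint_weight_def by blast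
  define h where "h = h' - (mat_trace h' / of_nat ?n) \<cdot>\<^sub>m 1\<^sub>m ?n"
  have h: "h \<in> carrier ?V" unfolding h_def by (rule trace_free_part[OF n hb])
  have wh: "coadjoint_weight a b F 1 h"
    using w parabolic_mem(1)[OF h] unfolding coadjoint_weight_def h_def
      commutator_subtract_scalar[OF Fc block_upper_carrier[OF hb]] by blast
  let ?\<phi> = "\<lambda>x. mat_trace (F * x)"
  note lin = linear_functional_trace[OF Fc]
  have "frobenius_functional ?V commutator ?\<phi>"
    using frobenius_functional_iff_matrix[OF n Fc lin] F by simp
  moreover have "principal_element ?V commutator ?\<phi> h"
    using principal_element_iff_weight[OF n Fc coadjoint_weight_one_trace[OF Fc w] _ h] wh by simp
  ultimately show "\<exists>\<phi> h. frobenius_functional ?V commutator \<phi> \<and> principal_element ?V commutator \<phi> h \<and>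
      image_mset of_int (parabolic_spectrum a b) = proots (operator_char_poly ?V (commutator h))"
    using proots_principal[OF cop F wh] by metis
next
  let ?V = "parabolic a b" and ?n = "a + b"
  have n: "0 < ?n" using cop by simp
  fix S assume "\<exists>\<phi> h. frobenius_functional ?V commutator \<phi> \<and> principal_element ?V commutator \<phi> h \<and>
      S = proots (operator_char_poly ?V (commutator h))"
  then obtain \<phi> h where fr: "frobenius_functional ?V commutator \<phi>" and pr: "principal_element ?V commutator \<phi> h"
    and S: "S = proots (operator_char_poly ?V (commutator h))" by blast
  have lin: "linear_functional ?V \<phi>" using fr unfolding frobenius_functional_def by blast
  obtain F where F: "F \<in> carrier_mat ?n ?n" "mat_trace F = 0" "\<And>x. x \<in> carrier ?V \<Longrightarrow> \<phi> x = mat_trace (F * x)"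
    using linear_functional_eq_trace[OF n lin] by blast
  have h: "h \<in> carrier ?V" using pr unfolding principal_element_def by blast
  have "frobenius_matrix a b F" using frobenius_functional_iff_matrix[OF n F(1) lin F(3)] fr by blast
  moreover have "coadjoint_weight a b F 1 h" using principal_element_iff_weight[OF n F h] pr by blast
  ultimately show "S = image_mset of_int (parabolic_spectrum a b)"
    unfolding S by (rule proots_principal[OF cop])
qed

theorem theorem1p1:
  fixes a b :: nat
  assumes "a > 0" and "b > 0" and "coprime a b"
  shows "\<exists>ks. increasing_eigenvalues (ooms_spectrum (parabolic a b) commutator) ks \<and>
    strictly_unimodal_central_pair
      (multiplicity_sequence (ooms_spectrum (parabolic a b) commutator) ks) \<and>
    ks ! (length ks div 2 - 1) = 0 \<and> ks ! (length ks div 2) = 1"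
  unfolding ooms_spectrum_parabolic[OF assms(3,1,2)]
  by (rule parabolic_spectrum_unimodal[OF assms(3,1,2)])

end
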